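(* Let $K_n$ be the complete directed graph on $n$ vertices whose edge weights are independent and uniformly distributed on $[0,1]$, and let $\mathcal{LSP}$ be the set of locally shortest paths in it. There is a constant $c$ such that $\Pr[|\mathcal{LSP}|\ge cn^2]=O(n^{-1/26})$.
   Context: Shortest paths are unique with probability 1. A path is a locally shortest path (LSP) if the path obtained by deleting its first edge and the path obtained by deleting its last edge are both shortest paths (empty paths count as shortest paths; every single edge is an LSP). *)

theory Defs
  imports "HOL-Probability.Probability" "HOL-Library.Landau_Symbols"
    "Graph_Theory.Shortest_Path" "Graph_Theory.Kuratowski"
begin

definition Kn :: "nat \<Rightarrow> (nat, nat \<times> nat) pre_digraph" where
  "Kn n = \<lparr> verts = {..<n}, arcs = {(u, v). u < n \<and> v < n \<and> u \<noteq> v}, tail = fst, head = snd \<rparr>"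

lemma complete_digraph_Kn: "complete_digraph n (Kn n)"
proof -
  have fin: "finite {(u, v). u < n \<and> v < n \<and> u \<noteq> v}"
    by (rule finite_subset[of _ "{..<n} \<times> {..<n}"]) auto
  then show ?thesis
    unfolding complete_digraph_def graph_def
    by (intro conjI; unfold_locales)
       (auto simp: Kn_def arcs_ends_def arc_to_ends_def sym_def symmetric_def)
qed

lemma graph_Kn: "graph (Kn n)"
  using complete_digraph_Kn by (simp add: complete_digraph_def)

context wf_digraph
begin

text \<open>
  A path is a simple directed path (\<^const>\<open>pre_digraph.apath\<close>), given as its list of arcs.
  The end points are determined by a nonempty list; for the empty list, \<open>u = v\<close> may be any
  vertex.
\<close>

definition shortest_path :: "'b weight_fun \<Rightarrow> 'b awalk \<Rightarrow> bool" where
  "shortest_path w p \<longleftrightarrow> (\<exists>u v. apath u p v \<and>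
     (\<forall>q. apath u q v \<longrightarrow> awalk_cost w p \<le> awalk_cost w q))"

text \<open>
  The condition on \<open>p\<close> refers to its first and last arc, so \<open>p\<close> is required to have one.
\<close>

definition LSP :: "'b weight_fun \<Rightarrow> 'b awalk set" where
  "LSP w = {p. p \<noteq> [] \<and> (\<exists>u v. apath u p v) \<and>
     shortest_path w (tl p) \<and> shortest_path w (butlast p)}"

lemma shortest_path_Nil:
  assumes "u \<in> verts G"
  shows "shortest_path w []"
proof -
  have "apath u [] u"
    using assms by (simp add: apath_def awalk_Nil_iff)
  moreover have "q = []" if "apath u q u" for q
  proof (cases q)
    case (Cons e es)
    then have "awalk (head G e) es u" "u \<notin> set (awalk_verts (head G e) es)"
      using that by (auto simp: apath_def awalk_Cons_iff)
    then show ?thesis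
      using awlast_in_verts[of "head G e" es] by (metis awalkE awalk_verts_ne_eq awhd_of_awalk last_in_set awalk_verts_non_Nil)
  qed
  ultimately show ?thesis
    unfolding shortest_path_def by blast
qed

lemma single_arc_in_LSP:
  assumes "e \<in> arcs G" "tail G e \<noteq> head G e"
  shows "[e] \<in> LSP w"
proof -
  have "apath (tail G e) [e] (head G e)"
    using assms by (auto simp: apath_def awalk_def)
  then show ?thesis
    using shortest_path_Nil[OF tail_in_verts[OF assms(1)], of w]
    by (auto simp: LSP_def)
qed

end

lemma (in fin_digraph) finite_LSP: "finite (LSP w)"
  by (rule finite_subset[OF _ finite_imageI[OF apaths_finite_triple, of "fst \<circ> snd"]])
     (force simp: LSP_def image_iff)

definition weights :: "nat \<Rightarrow> (nat \<times> nat \<Rightarrow> real) measure" where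
  "weights n = PiM (arcs (Kn n)) (\<lambda>_. uniform_measure lborel {0..1})"

lemma prob_space_weights: "prob_space (weights n)"
  unfolding weights_def
  by (intro prob_space_PiM prob_space_uniform_measure) auto

lemma measurable_card_LSP:
  "(\<lambda>w. real (card (wf_digraph.LSP (Kn n) w))) \<in> borel_measurable (weights n)"
proof -
  interpret graph "Kn n" by (rule graph_Kn)
  define S where "S = {p. \<exists>u v. apath u p v}"
  have finS: "finite S"
    unfolding S_def
    by (rule finite_subset[OF _ finite_imageI[OF apaths_finite_triple, of "fst \<circ> snd"]])
       (force simp: image_iff)
  have cost: "(\<lambda>w. awalk_cost w p) \<in> borel_measurable (weights n)"
    if "apath u p v" for u p v
  proof -
    have "set p \<subseteq> arcs (Kn n)" using that by (auto simp: apath_def awalk_def)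
    then show ?thesis
    proof (induction p)
      case (Cons e p)
      have "(\<lambda>w. w e) \<in> borel_measurable (weights n)"
        unfolding weights_def using Cons.prems
        by (intro measurable_component_singleton[THEN measurable_compose]) auto
      with Cons show ?case by simp
    qed simp
  qed
  have sp: "Measurable.pred (weights n) (\<lambda>w. shortest_path w p)" for p
  proof -
    define T where "T = {(u, p, v). apath u p v}"
    have finT: "finite T" unfolding T_def by (rule apaths_finite_triple)
    have "(\<lambda>w. shortest_path w p) = (\<lambda>w. \<exists>x\<in>T. fst (snd x) = p \<and>
        (\<forall>y\<in>T. fst y = fst x \<and> snd (snd y) = snd (snd x) \<longrightarrow>
           awalk_cost w (fst (snd x)) \<le> awalk_cost w (fst (snd y))))"
      by (auto simp: fun_eq_iff shortest_path_def T_def Bex_def Ball_def)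
    also have "Measurable.pred (weights n) \<dots>"
    proof (intro pred_intros_finite(3,4) finT pred_intros_logic)
      fix x y assume "x \<in> T" "y \<in> T"
      then have "(\<lambda>w. awalk_cost w (fst (snd x))) \<in> borel_measurable (weights n)"
        "(\<lambda>w. awalk_cost w (fst (snd y))) \<in> borel_measurable (weights n)"
        using cost by (auto simp: T_def)
      then show "Measurable.pred (weights n)
          (\<lambda>w. awalk_cost w (fst (snd x)) \<le> awalk_cost w (fst (snd y)))"
        unfolding pred_def by (rule borel_measurable_le)
    qed auto
    finally show ?thesis .
  qed
  have "real (card (LSP w)) = (\<Sum>p\<in>S. if p \<noteq> [] \<and>
      shortest_path w (tl p) \<and> shortest_path w (butlast p) then 1 else 0)" for w
  proof -
    have "LSP w = {p \<in> S. p \<noteq> [] \<and> shortest_path w (tl p) \<and> shortest_path w (butlast p)}"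
      unfolding LSP_def S_def by blast
    then show ?thesis using finS by (simp add: sum.If_cases Int_def)
  qed
  moreover have "(\<lambda>w. \<Sum>p\<in>S. if p \<noteq> [] \<and> shortest_path w (tl p) \<and>
      shortest_path w (butlast p) then 1 else 0 :: real) \<in> borel_measurable (weights n)"
  proof (intro borel_measurable_sum measurable_If)
    fix p
    have "Measurable.pred (weights n)
        (\<lambda>w. p \<noteq> [] \<and> shortest_path w (tl p) \<and> shortest_path w (butlast p))"
      by (intro pred_intros_logic sp) auto
    then show "{w \<in> space (weights n). p \<noteq> [] \<and> shortest_path w (tl p) \<and>
        shortest_path w (butlast p)} \<in> sets (weights n)"
      by (simp add: pred_def)
  qed auto
  ultimately show ?thesis by simp
qed

end

theory Submission
  imports Defs "HOL-Real_Asymp.Real_Asymp"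
begin

text \<open>
  A locally shortest path with at least two arcs consists of a first arc \<open>(u, a)\<close>, the shortest
  path from \<open>a\<close> to \<open>b\<close> and a last arc \<open>(b, v)\<close>, where \<open>v\<close> is a child of \<open>b\<close> in the tree of
  shortest paths from \<open>a\<close> and \<open>u\<close> is a child of \<open>a\<close> in the tree of shortest paths to \<open>b\<close>. As
  \<open>x y \<le> (x\<^sup>2 + y\<^sup>2) / 2\<close>, it suffices to bound, for every root \<open>s\<close>, the sum \<open>Z\<close> of the
  squares of the numbers of children in the tree of shortest paths from \<open>s\<close>, and the same in the
  reversed graph, which has the same distribution.

  Dijkstra's algorithm grows this tree like a random recursive tree: as long as all distances are
  at most \<open>1 / 2\<close>, every boundary arc is the next tree arc with conditional probability at most
  twice the uniform one. An arc out of a vertex with \<open>d\<close> children increases \<open>Z\<close> by \<open>2 d + 1\<close>,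
  which in expectation is at most \<open>6\<close>. Hence \<open>Z\<close> exceeds \<open>6 t\<close> after \<open>t\<close> steps by an amount
  with second moment \<open>O(t)\<close>, by the orthogonality of martingale increments. Summing over the
  roots, the number of locally shortest paths exceeds \<open>8 n\<^sup>2\<close> with probability \<open>O(1 / n)\<close> only,
  since paths with two arcs show that distances above \<open>1 / 2\<close> are exponentially unlikely.
\<close>

section \<open>Exploration by Dijkstra's algorithm\<close>

lemma Kn_simps [simp]:
  "verts (Kn n) = {..<n}" "tail (Kn n) = fst" "head (Kn n) = snd"
  "(u, v) \<in> arcs (Kn n) \<longleftrightarrow> u < n \<and> v < n \<and> u \<noteq> v"
  by (auto simp: Kn_def)

text \<open>The histories of Dijkstra's algorithm are lists of tree arcs, the newest arc first.\<close>

definition reached :: "nat \<Rightarrow> (nat \<times> nat) list \<Rightarrow> nat set" where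
  "reached s h = insert s (snd ` set h)"

definition boundary :: "nat \<Rightarrow> nat \<Rightarrow> (nat \<times> nat) list \<Rightarrow> (nat \<times> nat) set" where
  "boundary n s h = reached s h \<times> ({..<n} - reached s h)"

primrec history :: "nat \<Rightarrow> nat \<Rightarrow> (nat \<times> nat) list \<Rightarrow> bool" where
  "history n s [] \<longleftrightarrow> True"
| "history n s (e # h) \<longleftrightarrow> history n s h \<and> e \<in> boundary n s h"

text \<open>\<open>dst w h u\<close> is meaningful for reached \<open>u\<close> only; it is \<open>0\<close> elsewhere.\<close>

primrec dst :: "(nat \<times> nat \<Rightarrow> real) \<Rightarrow> (nat \<times> nat) list \<Rightarrow> nat \<Rightarrow> real" where
  "dst w [] = (\<lambda>_. 0)"
| "dst w (e # h) = (dst w h)(snd e := dst w h (fst e) + w e)"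

text \<open>In a settled history the vertices come in increasing order of distance, so this is also
  the largest distance of a reached vertex, see \<open>dst_bounds\<close>.\<close>

definition radius :: "(nat \<times> nat \<Rightarrow> real) \<Rightarrow> (nat \<times> nat) list \<Rightarrow> real" where
  "radius w h = (case h of [] \<Rightarrow> 0 | e # _ \<Rightarrow> dst w h (snd e))"

lemma radius_simps [simp]:
  "radius w [] = 0"
  "radius w (e # h) = dst w h (fst e) + w e"
  by (simp_all add: radius_def)

text \<open>The exploration is stopped when its radius exceeds \<open>1 / 2\<close>. Up to then a boundary arc
  \<open>f\<close> is conditioned on \<open>w f > radius w h - dst w h (fst f)\<close>, a threshold of at most \<open>1 / 2\<close>,
  so that its hazard rate lies between \<open>1\<close> and \<open>2\<close>. Whether \<open>h\<close> is settled depends only on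
  the arcs that enter reached vertices, unlike \<open>explores\<close> below.\<close>

primrec settled :: "nat \<Rightarrow> nat \<Rightarrow> (nat \<times> nat \<Rightarrow> real) \<Rightarrow> (nat \<times> nat) list \<Rightarrow> bool" where
  "settled n s w [] \<longleftrightarrow> True"
| "settled n s w (e # h) \<longleftrightarrow> settled n s w h \<and>
     radius w h < radius w (e # h) \<and> radius w (e # h) \<le> 1 / 2 \<and>
     (\<forall>f\<in>boundary n s h. snd f = snd e \<and> f \<noteq> e \<longrightarrow> radius w (e # h) < dst w h (fst f) + w f)"

text \<open>Once the weights of the arcs into reached vertices are fixed, the second clause
  constrains only arcs into unreached vertices. This separation is what permits Fubini in
  \<open>emeasure_explored_Cons\<close>.\<close>

definition explores :: "nat \<Rightarrow> nat \<Rightarrow> (nat \<times> nat \<Rightarrow> real) \<Rightarrow> (nat \<times> nat) list \<Rightarrow> bool" where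
  "explores n s w h \<longleftrightarrow> settled n s w h \<and>
     (\<forall>f\<in>boundary n s h. radius w h < dst w h (fst f) + w f)"

lemma reached_simps [simp]:
  "reached s [] = {s}"
  "reached s (e # h) = insert (snd e) (reached s h)"
  by (auto simp: reached_def)

lemma root_in_reached [simp]: "s \<in> reached s h"
  by (simp add: reached_def)

lemma finite_reached [simp]: "finite (reached s h)"
  by (simp add: reached_def)

lemma finite_boundary [simp]: "finite (boundary n s h)"
  by (simp add: boundary_def)

lemma boundaryD:
  assumes "e \<in> boundary n s h"
  shows "fst e \<in> reached s h" "snd e < n" "snd e \<notin> reached s h"
  using assms by (auto simp: boundary_def)

locale search =
  fixes n s :: nat
  assumes root: "s < n"
begin

section \<open>Combinatorics of histories, and bounds on distances\<close>

lemma reached_less: "history n s h \<Longrightarrow> reached s h \<subseteq> {..<n}"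
  using root by (induction h) (auto dest: boundaryD)

lemma card_reached: "history n s h \<Longrightarrow> card (reached s h) = Suc (length h)"
  by (induction h) (auto dest: boundaryD)

lemma length_history: "history n s h \<Longrightarrow> length h < n"
  using card_reached[of h] card_mono[OF finite_lessThan reached_less[of h]] by simp

lemma reached_all:
  assumes "history n s h" "Suc (length h) = n"
  shows "reached s h = {..<n}"
  using assms card_reached reached_less by (intro card_subset_eq) auto

lemma card_boundary:
  assumes "history n s h"
  shows "card (boundary n s h) = Suc (length h) * (n - Suc (length h))"
  using assms reached_less[OF assms] card_reached[OF assms]
  by (simp add: boundary_def card_cartesian_product card_Diff_subset del: mult_Suc)

lemma boundary_subset_arcs: "history n s h \<Longrightarrow> boundary n s h \<subseteq> arcs (Kn n)"
  using reached_less by (fastforce simp: boundary_def Kn_def)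

lemma set_history:
  assumes "history n s h"
  shows "set h \<subseteq> arcs (Kn n)" and "(u, x) \<in> set h \<Longrightarrow> u \<in> reached s h \<and> x \<in> reached s h \<and> x \<noteq> s"
  using assms boundary_subset_arcs by (induction h) (fastforce simp: boundary_def)+

lemma history_unique_parent:
  assumes "history n s h" "(u, x) \<in> set h" "(v, x) \<in> set h"
  shows "u = v"
  using assms set_history(2)
  by (induction h) (fastforce simp: boundary_def)+

lemma distinct_history: "history n s h \<Longrightarrow> distinct h"
  using set_history(2) by (induction h) (fastforce simp: boundary_def)+

lemma dst_root: "history n s h \<Longrightarrow> dst w h s = 0"
  by (induction h) (auto simp: boundary_def)

lemma dst_bounds:
  assumes "history n s h" "settled n s w h" "u \<in> reached s h"
  shows "0 \<le> dst w h u" "dst w h u \<le> radius w h"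
proof -
  have "0 \<le> dst w h u \<and> dst w h u \<le> radius w h" using assms
  proof (induction h arbitrary: u)
    case (Cons e h)
    then have "0 \<le> dst w h v \<and> dst w h v \<le> radius w h" if "v \<in> reached s h" for v
      using that by simp
    from this[of s] this[of u] Cons.prems show ?case by (cases "u = snd e") auto
  qed simp
  then show "0 \<le> dst w h u" "dst w h u \<le> radius w h" by auto
qed

lemma radius_bounds:
  assumes "history n s h" "settled n s w h"
  shows "0 \<le> radius w h" "radius w h \<le> 1 / 2"
  using dst_bounds[OF assms, of s] dst_root[OF assms(1)] assms by (auto, cases h, auto)

text \<open>A rival of the newest arc \<open>e\<close> either enters the same vertex, where
  \<open>settled\<close> compares the two, or it is still a boundary arc after the step, with the
  distance of its tail unchanged, and then lies beyond the new radius. So \<open>e\<close> is the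
  strict minimiser among all boundary arcs.\<close>

lemma explores_ConsD:
  assumes "history n s (e # h)" "explores n s w (e # h)"
  shows "explores n s w h"
    and "f \<in> boundary n s h \<Longrightarrow> f \<noteq> e \<Longrightarrow> dst w h (fst e) + w e < dst w h (fst f) + w f"
    and "radius w h < dst w h (fst e) + w e"
proof -
  have e: "e \<in> boundary n s h" and set: "settled n s w h"
    and r: "radius w h < dst w h (fst e) + w e"
    using assms by (auto simp: explores_def)
  show *: "dst w h (fst e) + w e < dst w h (fst f) + w f" if f: "f \<in> boundary n s h" "f \<noteq> e" for f
  proof (cases "snd f = snd e")
    case True
    then show ?thesis using assms f by (auto simp: explores_def)
  next
    case False
    then have "f \<in> boundary n s (e # h)" using f by (auto simp: boundary_def)
    moreover have "fst f \<noteq> snd e" using f e by (auto simp: boundary_def)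
    ultimately show ?thesis using assms(2) by (force simp: explores_def)
  qed
  show "radius w h < dst w h (fst e) + w e" by fact
  show "explores n s w h"
    using * r set by (force simp: explores_def)
qed

text \<open>Each of two different next arcs would have to beat the other strictly.\<close>

lemma explores_disjoint:
  assumes "history n s (e # h)" "explores n s w (e # h)"
    and "history n s (f # h)" "explores n s w (f # h)"
  shows "e = f"
proof (rule ccontr)
  assume "e \<noteq> f"
  with explores_ConsD(2)[OF assms(1,2), of f] explores_ConsD(2)[OF assms(3,4), of e] assms(1,3)
  show False by auto
qed

text \<open>Quantifying over all histories, not only those that \<open>w\<close> produces, makes
  this a finite conjunction of conditions each of which holds almost surely.\<close>

definition tie_free :: "(nat \<times> nat \<Rightarrow> real) \<Rightarrow> bool" where
  "tie_free w \<longleftrightarrow> (\<forall>h. history n s h \<longrightarrow> (\<forall>e\<in>boundary n s h. \<forall>f\<in>boundary n s h.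
     e \<noteq> f \<longrightarrow> dst w h (fst e) + w e \<noteq> dst w h (fst f) + w f))"

text \<open>The optimality conditions of a shortest path tree: tree arcs are tight, all others
  strictly slack. When \<open>x\<close> is added, other arcs into \<open>x\<close> lose by
  \<open>settled\<close>, and arcs out of \<open>x\<close> are slack because \<open>x\<close> is the
  farthest reached vertex and weights are positive.\<close>

lemma settled_arc:
  assumes "history n s h" "settled n s w h" and pos: "\<And>e. e \<in> arcs (Kn n) \<Longrightarrow> 0 < w e"
    and "a \<in> reached s h" "b \<in> reached s h" "a \<noteq> b"
  shows "(a, b) \<in> set h \<Longrightarrow> dst w h b = dst w h a + w (a, b)"
    and "(a, b) \<notin> set h \<Longrightarrow> dst w h b < dst w h a + w (a, b)"
proof -
  have "((a, b) \<in> set h \<longrightarrow> dst w h b = dst w h a + w (a, b)) \<and>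
    ((a, b) \<notin> set h \<longrightarrow> dst w h b < dst w h a + w (a, b))"
    using assms(1,2,4-)
  proof (induction h arbitrary: a b)
    case (Cons e h)
    then have e: "e \<in> boundary n s h" and hist: "history n s h" and set: "settled n s w h" by auto
    obtain u x where ux: "e = (u, x)" by force
    have u: "u \<in> reached s h" and x: "x \<notin> reached s h" using e ux by (auto simp: boundary_def)
    have notin: "(a, x) \<notin> set h" "(x, b) \<notin> set h" for a b
      using set_history(2)[OF hist] x by auto
    have ab: "(a, b) \<in> arcs (Kn n)"
      using reached_less[OF Cons.prems(1)] Cons.prems(3-5) by auto
    consider "b = x" "a \<noteq> x" | "a = x" "b \<noteq> x" | "a \<noteq> x" "b \<noteq> x" using Cons.prems by blast
    then show ?case
    proof cases
      case 1
      then have "(a, b) \<in> boundary n s h" using Cons.prems x reached_less[OF Cons.prems(1)] ux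
        by (auto simp: boundary_def)
      with 1 Cons.prems show ?thesis using notin u x
        by (cases "a = u") (auto simp: ux)
    next
      case 2
      then have "dst w h b \<le> radius w h" using dst_bounds[OF hist set] Cons.prems ux by auto
      also have "\<dots> < dst w h u + w (u, x)" using Cons.prems ux by simp
      also have "\<dots> < dst w h u + w (u, x) + w (x, b)" using pos[OF ab] 2 by simp
      finally show ?thesis using 2 u x notin ux by auto
    next
      case 3
      then show ?thesis using Cons ux by auto
    qed
  qed simp
  then show "(a, b) \<in> set h \<Longrightarrow> dst w h b = dst w h a + w (a, b)"
    and "(a, b) \<notin> set h \<Longrightarrow> dst w h b < dst w h a + w (a, b)" by auto
qed

text \<open>Under the two-hop condition every vertex is within distance \<open>1/2\<close> of the root, so the
  exploration never stops before it is complete.\<close>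

lemma explores_extend:
  assumes hist: "history n s h" and ex: "explores n s w h" and less: "Suc (length h) < n"
    and pos: "\<And>e. e \<in> arcs (Kn n) \<Longrightarrow> 0 < w e" and tf: "tie_free w"
    and hop: "\<And>y. y < n \<Longrightarrow> y \<noteq> s \<Longrightarrow>
      \<exists>z<n. z \<noteq> s \<and> z \<noteq> y \<and> w (s, z) \<le> 1 / 4 \<and> w (z, y) \<le> 1 / 4"
  shows "\<exists>e. history n s (e # h) \<and> explores n s w (e # h)"
proof -
  define g where "g = (\<lambda>f. dst w h (fst f) + w f)"
  have set: "settled n s w h" using ex by (simp add: explores_def)
  have "\<not> {..<n} \<subseteq> reached s h"
    using card_mono[OF finite_reached, of "{..<n}" s h] less card_reached[OF hist] by auto
  then obtain y where y: "y < n" "y \<notin> reached s h" by auto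
  have "y \<noteq> s" using y by auto
  with hop y obtain z where z: "z < n" "z \<noteq> s" "z \<noteq> y" "w (s, z) \<le> 1 / 4" "w (z, y) \<le> 1 / 4"
    by blast
  \<comment> \<open>If \<open>z\<close> is reached, its distance is at most 1/4 and the arc to the
    unreached \<open>y\<close> has key at most 1/2; otherwise the arc from the root to
    \<open>z\<close> is itself a boundary arc.\<close>
  obtain f where f: "f \<in> boundary n s h" "g f \<le> 1 / 2"
  proof (cases "z \<in> reached s h")
    case True
    have "dst w h z \<le> dst w h s + w (s, z)"
      using settled_arc[OF hist set pos root_in_reached True] z(2) by (cases "(s, z) \<in> set h") auto
    then show ?thesis using that[of "(z, y)"] True y z dst_root[OF hist]
      by (auto simp: boundary_def g_def)
  next
    case False
    then show ?thesis using that[of "(s, z)"] z dst_root[OF hist]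
      by (auto simp: boundary_def g_def)
  qed
  obtain e where e: "e \<in> boundary n s h" "\<And>f. f \<in> boundary n s h \<Longrightarrow> g e \<le> g f"
    using ex_is_arg_min_if_finite[of "boundary n s h" g] f(1) finite_boundary
    by (metis empty_iff is_arg_min_linorder)
  have strict: "g e < g f" if "f \<in> boundary n s h" "f \<noteq> e" for f
    using tf e(2)[OF that(1)] that e(1) hist unfolding tie_free_def g_def
    by (metis order_le_less)
  have rad: "radius w h < g e" using ex e(1) by (auto simp: explores_def g_def)
  have "g e \<le> 1 / 2" using e(2)[OF f(1)] f(2) by simp
  then have "settled n s w (e # h)"
    using strict rad set by (auto simp: g_def)
  moreover have "radius w (e # h) < dst w (e # h) (fst f) + w f" if "f \<in> boundary n s (e # h)" for f
  proof (cases "fst f = snd e")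
    case True
    have "history n s (e # h)" using hist e by simp
    then have "0 < w f" using boundary_subset_arcs that pos by blast
    then show ?thesis using True by simp
  next
    case False
    then have "f \<in> boundary n s h" "f \<noteq> e" using that by (auto simp: boundary_def)
    then show ?thesis using strict[of f] False by (simp add: g_def)
  qed
  ultimately have "explores n s w (e # h)" by (simp add: explores_def)
  then show ?thesis using hist e(1) by (intro exI[of _ e]) simp
qed

lemma explores_complete:
  assumes pos: "\<And>e. e \<in> arcs (Kn n) \<Longrightarrow> 0 < w e" and tf: "tie_free w"
    and hop: "\<And>y. y < n \<Longrightarrow> y \<noteq> s \<Longrightarrow>
      \<exists>z<n. z \<noteq> s \<and> z \<noteq> y \<and> w (s, z) \<le> 1 / 4 \<and> w (z, y) \<le> 1 / 4"
  shows "\<exists>h. history n s h \<and> Suc (length h) = n \<and> explores n s w h"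
proof -
  have "t < n \<Longrightarrow> \<exists>h. history n s h \<and> length h = t \<and> explores n s w h" for t
  proof (induction t)
    case 0
    have "explores n s w []" using pos root
      by (auto simp: explores_def boundary_def)
    then show ?case by (auto intro!: exI[of _ "[]"])
  next
    case (Suc t)
    then obtain h where "history n s h" "length h = t" "explores n s w h" by auto
    with explores_extend[OF this(1,3) _ pos tf hop] Suc.prems show ?case
      by (metis length_Cons)
  qed
  from this[of "n - 1"] root show ?thesis by fastforce
qed

text \<open>The tree path realises \<open>dst\<close>. Keeping its vertices inside the reached set
  is what makes the path simple when an arc to a new vertex is appended; a simple path is needed as
  a competitor in \<open>shortest_path\<close>.\<close>

lemma settled_path:
  assumes "history n s h" "u \<in> reached s h"
  shows "\<exists>p. pre_digraph.apath (Kn n) s p u \<and> set (pre_digraph.awalk_verts (Kn n) s p) \<subseteq> reached s h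
    \<and> wf_digraph.awalk_cost w p = dst w h u"
  using assms
proof (induction h arbitrary: u)
  case Nil
  interpret graph "Kn n" by (rule graph_Kn)
  show ?case using Nil root by (intro exI[of _ "[]"]) (auto simp: apath_Nil_iff)
next
  case (Cons e h)
  interpret graph "Kn n" by (rule graph_Kn)
  show ?case
  proof (cases "u = snd e")
    case True
    have e: "fst e \<in> reached s h" "snd e \<notin> reached s h" "e \<in> arcs (Kn n)"
      using Cons.prems boundary_subset_arcs[of h] by (auto simp: boundary_def)
    from Cons e obtain p where p: "apath s p (fst e)" "set (awalk_verts s p) \<subseteq> reached s h"
      "awalk_cost w p = dst w h (fst e)" by auto
    have cas: "awlast s p = fst e" using p(1) by (auto simp: apath_def)
    have "apath (fst e) [e] (snd e)" using e
      by (cases e) (auto simp: apath_def awalk_def)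
    then have "apath s (p @ [e]) (snd e)" using p e cas
      by (auto simp: apath_append_iff)
    moreover have "set (awalk_verts s (p @ [e])) \<subseteq> insert (snd e) (reached s h)"
      using p(2) set_awalk_verts_append[of s p "fst e" "[e]" "snd e"] \<open>apath (fst e) [e] (snd e)\<close> p(1) e(1)
      by (auto simp: apath_def)
    ultimately show ?thesis using True p(3) by (intro exI[of _ "p @ [e]"]) auto
  next
    case False
    with Cons obtain p where "apath s p u" "set (awalk_verts s p) \<subseteq> reached s h"
      "awalk_cost w p = dst w h u" by auto
    with False show ?thesis by (intro exI[of _ p]) auto
  qed
qed

end

section \<open>The first of several shifted uniform variables\<close>

abbreviation unif :: "real measure" where
  "unif \<equiv> uniform_measure lborel {0..1}"

lemma prob_space_unif: "prob_space unif"
  by (rule prob_space_uniform_measure) auto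

interpretation unif: prob_space unif
  by (rule prob_space_unif)

interpretation unif_product: product_prob_space "\<lambda>_. unif" I for I
  by unfold_locales

lemma ennreal_divide_1 [simp]: "x / (1 :: ennreal) = x"
  by (simp add: divide_ennreal_def)

lemma prod_mono_ennreal:
  fixes f g :: "'i \<Rightarrow> ennreal"
  assumes "\<And>i. i \<in> A \<Longrightarrow> f i \<le> g i"
  shows "prod f A \<le> prod g A"
  using assms by (induction A rule: infinite_finite_induct) (auto intro!: mult_mono)

lemma nn_integral_unif:
  assumes "f \<in> borel_measurable borel"
  shows "(\<integral>\<^sup>+ y. f y \<partial>unif) = (\<integral>\<^sup>+ y. f y * indicator {0..1} y \<partial>lborel)"
  using assms by (subst nn_integral_uniform_measure) simp_all

text \<open>For \<open>a > 1\<close> both sides vanish, because \<open>ennreal\<close> truncates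
  negative reals to 0.\<close>

lemma emeasure_unif_greaterThan:
  assumes "0 \<le> a"
  shows "emeasure unif {a<..} = ennreal (1 - a)"
proof -
  have "{0..1} \<inter> {a<..} = {a<..1}" using assms by auto
  then show ?thesis
    by (cases "a \<le> 1") (simp_all add: ennreal_neg)
qed

lemma emeasure_unif_atMost:
  assumes "0 \<le> a" "a \<le> 1"
  shows "emeasure unif {..a} = ennreal a"
  using assms by simp

lemma measurable_coordinate:
  assumes "f \<in> J"
  shows "(\<lambda>y. y f) \<in> borel_measurable (PiM J (\<lambda>_. unif))"
  using measurable_component_singleton[OF assms, of "\<lambda>_. unif"]
  by (simp cong: measurable_cong_sets)

lemma emeasure_all_above:
  assumes "finite J" "B \<subseteq> J" "\<And>f. f \<in> B \<Longrightarrow> 0 \<le> a f"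
  shows "emeasure (PiM J (\<lambda>_. unif)) {y \<in> space (PiM J (\<lambda>_. unif)). \<forall>f\<in>B. a f < y f}
    = (\<Prod>f\<in>B. ennreal (1 - a f))"
proof -
  have "emeasure (PiM J (\<lambda>_. unif)) {y \<in> space (PiM J (\<lambda>_. unif)). \<forall>f\<in>B. y f \<in> {a f<..}}
    = (\<Prod>f\<in>B. emeasure unif {a f<..})"
    using assms(2) finite_subset[OF assms(2,1)] by (rule unif_product.emeasure_PiM_Collect) simp
  also have "\<dots> = (\<Prod>f\<in>B. ennreal (1 - a f))"
    using assms(3) by (intro prod.cong emeasure_unif_greaterThan) auto
  finally show ?thesis by simp
qed

text \<open>Here \<open>y - a\<close> is the overshoot of the winning arc over its threshold, and
  \<open>k\<close> the number of its rivals. The integral over [a, 1] is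
  \<open>(1 - a ^ (k + 1)) / (k + 1)\<close>.\<close>

lemma nn_integral_power_le:
  assumes "0 \<le> a" "a \<le> 1"
  shows "(\<integral>\<^sup>+ y. ennreal ((1 - (y - a)) ^ k) * indicator {a<..} y \<partial>unif) \<le> ennreal (1 / (k + 1))"
proof -
  have "(\<integral>\<^sup>+ y. ennreal ((1 - (y - a)) ^ k) * indicator {a<..} y \<partial>unif)
      = (\<integral>\<^sup>+ y. ennreal ((1 - (y - a)) ^ k) * indicator {a<..} y * indicator {0..1} y \<partial>lborel)"
    by (rule nn_integral_unif) measurable
  also have "\<dots> \<le> (\<integral>\<^sup>+ y. ennreal ((1 - (y - a)) ^ k) * indicator {a..1} y \<partial>lborel)"
    by (intro nn_integral_mono) (auto simp: indicator_def)
  also have "\<dots> = ennreal (- ((1 - (1 - a)) ^ (k + 1) / (k + 1)) - (- ((1 - (a - a)) ^ (k + 1) / (k + 1))))"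
  proof (rule nn_integral_FTC_Icc)
    show "DERIV (\<lambda>y. - ((1 - (y - a)) ^ (k + 1) / (k + 1))) x :> (1 - (x - a)) ^ k" for x
    proof -
      have "DERIV (\<lambda>y. 1 - (y - a)) x :> - 1"
        by (auto intro!: derivative_eq_intros)
      from DERIV_minus[OF DERIV_cdivide[OF DERIV_power_Suc[OF this, of k], of "real (k + 1)"]]
      show ?thesis by (simp add: divide_simps)
    qed
  qed (use assms in auto)
  also have "\<dots> \<le> ennreal (1 / (k + 1))"
    using assms by (intro ennreal_leI) (auto simp: field_simps)
  finally show ?thesis by (simp add: add.commute)
qed

lemma measurable_tail:
  "(\<lambda>y. ennreal ((1 - (y - a)) ^ k) * indicator {a<..} y) \<in> borel_measurable unif"
proof -
  have "(\<lambda>y. ennreal ((1 - (y - a)) ^ k) * indicator {a<..} y) \<in> borel_measurable borel"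
    by measurable
  then show ?thesis by (simp cong: measurable_cong_sets)
qed

text \<open>If \<open>e\<close> exceeds its threshold by \<open>t\<close>, a rival \<open>f\<close>
  exceeds its own by more than \<open>t\<close> with probability at most
  \<open>(1 - a f) * (1 - t)\<close>, since the two sides differ by \<open>a f * t\<close>.
  Integrating the power of \<open>1 - t\<close> over \<open>t\<close> gives at most
  \<open>1 / card B\<close>. The factor \<open>1 - a e\<close>, absent so far, is at least 1/2,
  which costs the factor 2.\<close>

lemma emeasure_first_above:
  fixes a :: "'i \<Rightarrow> real"
  assumes J: "finite J" "B \<subseteq> J" and e: "e \<in> B"
    and a: "\<And>f. f \<in> B \<Longrightarrow> 0 \<le> a f" "\<And>f. f \<in> B \<Longrightarrow> a f \<le> 1 / 2"
  shows "emeasure (PiM J (\<lambda>_. unif))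
      {y \<in> space (PiM J (\<lambda>_. unif)). a e < y e \<and> (\<forall>f\<in>B - {e}. y e - a e < y f - a f)}
    \<le> ennreal (2 / card B) * (\<Prod>f\<in>B. ennreal (1 - a f))"
proof -
  define J' B' where "J' = J - {e}" and "B' = B - {e}"
  have J': "finite J'" "e \<notin> J'" "J = insert e J'" "B' \<subseteq> J'" "finite B'" "B = insert e B'" "e \<notin> B'"
    using assms finite_subset[OF J(2,1)] by (auto simp: J'_def B'_def)
  let ?P = "\<lambda>J. PiM J (\<lambda>_::'i. unif)"
  define S where "S = {y \<in> space (?P J). a e < y e \<and> (\<forall>f\<in>B'. y e - a e < y f - a f)}"
  have comp: "(\<lambda>y. y f) \<in> borel_measurable (?P J)" if "f \<in> B" for f
    using that J by (intro measurable_coordinate) auto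
  have [measurable]: "(\<lambda>y. y f) \<in> borel_measurable (?P J)" if "f \<in> B'" for f
    using comp that J'(6) by simp
  have [measurable]: "(\<lambda>y. y e) \<in> borel_measurable (?P J)"
    using comp e .
  have [measurable]: "S \<in> sets (?P J)"
    unfolding S_def using J'(5) by measurable
  have "emeasure (?P J) S = (\<integral>\<^sup>+ y. indicator S y \<partial>?P J)" by simp
  also have "\<dots> = (\<integral>\<^sup>+ y. (\<integral>\<^sup>+ x. indicator S (x(e := y)) \<partial>?P J') \<partial>unif)"
    unfolding J'(3) using J' \<open>S \<in> sets (?P J)\<close>
    by (intro unif_product.product_nn_integral_insert_rev) auto
  also have "\<dots> \<le> (\<integral>\<^sup>+ y. (\<Prod>f\<in>B'. ennreal (1 - a f)) *
      (ennreal ((1 - (y - a e)) ^ card B') * indicator {a e<..} y) \<partial>unif)"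
  \<comment> \<open>Almost everywhere \<open>y\<close> is at most 1, so that
    \<open>1 - (y - a e)\<close> is nonnegative and \<open>ennreal\<close> is multiplicative on
    it.\<close>
  proof (rule nn_integral_mono_AE)
    have "AE y in unif. y \<in> {0..1}"
      by (intro AE_uniform_measureI) auto
    then show "AE y in unif. (\<integral>\<^sup>+ x. indicator S (x(e := y)) \<partial>?P J') \<le> (\<Prod>f\<in>B'. ennreal (1 - a f)) *
      (ennreal ((1 - (y - a e)) ^ card B') * indicator {a e<..} y)"
    proof eventually_elim
      case (elim y)
      show ?case
      proof (cases "a e < y")
        case True
        have "(\<integral>\<^sup>+ x. indicator S (x(e := y)) \<partial>?P J') =
            (\<integral>\<^sup>+ x. indicator {x \<in> space (?P J'). \<forall>f\<in>B'. a f + (y - a e) < x f} x \<partial>?P J')"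
        proof (intro nn_integral_cong)
          fix x assume x: "x \<in> space (?P J')"
          then have "x(e := y) \<in> space (?P J)"
            using J' by (auto simp: space_PiM PiE_def extensional_def)
          moreover have "y - a e < (x(e := y)) f - a f \<longleftrightarrow> a f + (y - a e) < x f" if "f \<in> B'" for f
            using that J'(7) by auto
          ultimately have "x(e := y) \<in> S \<longleftrightarrow> (\<forall>f\<in>B'. a f + (y - a e) < x f)"
            using True by (simp add: S_def)
          with x show "indicator S (x(e := y)) =
            (indicator {x \<in> space (?P J'). \<forall>f\<in>B'. a f + (y - a e) < x f} x :: ennreal)"
            by (simp add: indicator_def)
        qed
        also have "\<dots> = (\<Prod>f\<in>B'. ennreal (1 - (a f + (y - a e))))"
        proof -
          have [measurable]: "(\<lambda>y. y f) \<in> borel_measurable (?P J')" if "f \<in> B'" for f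
            using that J'(4) by (intro measurable_coordinate) auto
          have "{x \<in> space (?P J'). \<forall>f\<in>B'. a f + (y - a e) < x f} \<in> sets (?P J')"
            using J'(5) by measurable
          then show ?thesis
            using emeasure_all_above[of J' B' "\<lambda>f. a f + (y - a e)"] J' a(1) True
            by (simp add: add_nonneg_nonneg)
        qed
        also have "\<dots> \<le> (\<Prod>f\<in>B'. ennreal (1 - a f) * ennreal (1 - (y - a e)))"
        proof (rule prod_mono_ennreal)
          fix f assume f: "f \<in> B'"
          have "0 \<le> a f * (y - a e)" using a(1)[of f] f J' True by simp
          then have "1 - (a f + (y - a e)) \<le> (1 - a f) * (1 - (y - a e))"
            by (simp add: algebra_simps)
          moreover have "0 \<le> 1 - a f" "0 \<le> 1 - (y - a e)"
            using a(2)[of f] f J' elim a(1)[OF e] by auto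
          ultimately show "ennreal (1 - (a f + (y - a e))) \<le> ennreal (1 - a f) * ennreal (1 - (y - a e))"
            by (metis ennreal_leI ennreal_mult)
        qed
        also have "\<dots> = (\<Prod>f\<in>B'. ennreal (1 - a f)) * ennreal ((1 - (y - a e)) ^ card B')"
          using elim a(1)[OF e] by (simp add: prod.distrib ennreal_power)
        finally show ?thesis using True by simp
      next
        case False
        then show ?thesis by (simp add: S_def nn_integral_0_iff_AE)
      qed
    qed
  qed
  also have "\<dots> = (\<Prod>f\<in>B'. ennreal (1 - a f)) *
      (\<integral>\<^sup>+ y. ennreal ((1 - (y - a e)) ^ card B') * indicator {a e<..} y \<partial>unif)"
    by (intro nn_integral_cmult measurable_tail)
  also have "\<dots> \<le> (\<Prod>f\<in>B'. ennreal (1 - a f)) * ennreal (1 / (card B' + 1))"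
    using a[OF e] nn_integral_power_le[of "a e" "card B'"]
    by (intro mult_left_mono) (auto simp: add.commute)
  also have "\<dots> \<le> (\<Prod>f\<in>B'. ennreal (1 - a f)) * (ennreal (2 / card B) * ennreal (1 - a e))"
  proof (intro mult_left_mono)
    have "1 / (card B' + 1) \<le> (2 / card B) * (1 - a e)"
      using a[OF e] J' by (simp add: field_simps)
    then have "ennreal (1 / (card B' + 1)) \<le> ennreal ((2 / card B) * (1 - a e))"
      by (rule ennreal_leI)
    also have "\<dots> = ennreal (2 / card B) * ennreal (1 - a e)"
      using a[OF e] by (intro ennreal_mult) auto
    finally show "ennreal (1 / (card B' + 1)) \<le> ennreal (2 / card B) * ennreal (1 - a e)" .
  qed auto
  also have "\<dots> = ennreal (2 / card B) * (\<Prod>f\<in>B. ennreal (1 - a f))"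
    using J' by (simp add: mult_ac)
  finally show ?thesis by (simp add: S_def B'_def)
qed

section \<open>The conditional law of the next tree arc\<close>

lemma weights_eq: "weights n = PiM (arcs (Kn n)) (\<lambda>_. unif)"
  by (simp add: weights_def)

lemma finite_arcs_Kn [simp]: "finite (arcs (Kn n))"
  by (rule finite_subset[of _ "{..<n} \<times> {..<n}"]) (auto simp: Kn_def)

lemma dst_cong: "(\<And>e. e \<in> set h \<Longrightarrow> w e = w' e) \<Longrightarrow> dst w h = dst w' h"
  by (induction h) auto

lemma radius_cong: "(\<And>e. e \<in> set h \<Longrightarrow> w e = w' e) \<Longrightarrow> radius w h = radius w' h"
  using dst_cong[of h w w'] by (cases h) (simp_all add: radius_def del: dst.simps)

context search
begin

text \<open>The tree arcs, and the rivals with which \<open>settled\<close> compares them, all enter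
  reached vertices.\<close>

lemma settled_cong:
  assumes "history n s h" "\<And>e. e \<in> arcs (Kn n) \<Longrightarrow> snd e \<in> reached s h \<Longrightarrow> w e = w' e"
  shows "settled n s w h = settled n s w' h"
  using assms
proof (induction h)
  case (Cons e h)
  have sub: "set (e # h) \<subseteq> {f \<in> arcs (Kn n). snd f \<in> reached s (e # h)}"
    using set_history[OF Cons.prems(1)] by force
  then have eq: "w f = w' f" if "f \<in> set (e # h)" for f
    using that Cons.prems(2) by blast
  then have "dst w h = dst w' h" "radius w h = radius w' h" "w e = w' e"
    by (auto intro!: dst_cong radius_cong)
  moreover have "w f = w' f" if "f \<in> boundary n s h" "snd f = snd e" for f
    using that Cons.prems boundary_subset_arcs[of h] by (intro Cons.prems(2)) auto
  ultimately show ?case using Cons by auto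
qed simp

section \<open>Measurability of the exploration\<close>

lemma measurable_dst:
  assumes "set h \<subseteq> J"
  shows "(\<lambda>w. dst w h u) \<in> borel_measurable (PiM J (\<lambda>_. unif))"
  using assms
proof (induction h arbitrary: u)
  case (Cons e h)
  have [measurable]: "(\<lambda>w. dst w h u) \<in> borel_measurable (PiM J (\<lambda>_. unif))" for u
    using Cons by simp
  have [measurable]: "(\<lambda>w. w e) \<in> borel_measurable (PiM J (\<lambda>_. unif))"
    using Cons by (intro measurable_coordinate) simp
  show ?case by (cases "u = snd e") simp_all
qed simp

lemma measurable_radius:
  assumes "set h \<subseteq> J"
  shows "(\<lambda>w. radius w h) \<in> borel_measurable (PiM J (\<lambda>_. unif))"
  using assms measurable_dst[of h] by (cases h) (simp_all add: radius_def del: dst.simps)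

lemma measurable_weight:
  "f \<in> boundary n s h \<Longrightarrow> history n s h \<Longrightarrow> (\<lambda>w. w f) \<in> borel_measurable (weights n)"
  using boundary_subset_arcs[of h] by (auto simp: weights_eq intro!: measurable_coordinate)

lemma measurable_settled:
  assumes "history n s h"
  shows "Measurable.pred (weights n) (\<lambda>w. settled n s w h)"
  using assms
proof (induction h)
  case (Cons e h)
  then have hist: "history n s h" and e: "e \<in> boundary n s h" by auto
  have [measurable]: "Measurable.pred (weights n) (\<lambda>w. settled n s w h)" using Cons by simp
  have [measurable]: "(\<lambda>w. dst w h u) \<in> borel_measurable (weights n)"
    "(\<lambda>w. radius w h) \<in> borel_measurable (weights n)" for u
    unfolding weights_eq by (intro measurable_dst measurable_radius set_history(1)[OF hist])+
  have [measurable]: "(\<lambda>w. w f) \<in> borel_measurable (weights n)" if "f \<in> boundary n s h" for f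
    using measurable_weight[OF that hist] .
  note [measurable] = measurable_weight[OF e hist]
  show ?case by simp measurable
qed simp

lemma measurable_explores:
  assumes "history n s h"
  shows "Measurable.pred (weights n) (\<lambda>w. explores n s w h)"
proof -
  note [measurable] = measurable_settled[OF assms] measurable_weight[OF _ assms]
  have [measurable]: "(\<lambda>w. dst w h u) \<in> borel_measurable (weights n)"
    "(\<lambda>w. radius w h) \<in> borel_measurable (weights n)" for u
    unfolding weights_eq by (intro measurable_dst measurable_radius set_history(1)[OF assms])+
  show ?thesis unfolding explores_def by measurable
qed

definition explored :: "(nat \<times> nat) list \<Rightarrow> (nat \<times> nat \<Rightarrow> real) set" where
  "explored h = {w \<in> space (weights n). explores n s w h}"

lemma sets_explored: "history n s h \<Longrightarrow> explored h \<in> sets (weights n)"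
  using measurable_explores by (simp add: explored_def pred_def)

text \<open>Fubini: the arcs into reached vertices determine whether \<open>h\<close> is settled, and for fixed
  values of these, only the arcs of the boundary compete for the next step.\<close>

lemma emeasure_explored_Cons:
  assumes "history n s (e # h)"
  shows "emeasure (weights n) (explored (e # h))
    \<le> ennreal (2 / card (boundary n s h)) * emeasure (weights n) (explored h)"
proof -
  have hist: "history n s h" and e: "e \<in> boundary n s h" using assms by auto
  define I where "I = {f \<in> arcs (Kn n). snd f \<in> reached s h}"
  define J where "J = {f \<in> arcs (Kn n). snd f \<notin> reached s h}"
  have IJ: "I \<inter> J = {}" "finite I" "finite J" "I \<union> J = arcs (Kn n)" by (auto simp: I_def J_def)
  have bJ: "boundary n s h \<subseteq> J"
    using boundary_subset_arcs[OF hist] by (auto simp: J_def boundary_def)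
  have hI: "set h \<subseteq> I" using set_history[OF hist] by (force simp: I_def)
  let ?P = "\<lambda>J. PiM J (\<lambda>_::nat \<times> nat. unif)"
  let ?S = "{x \<in> space (?P I). settled n s x h}"
  \<comment> \<open>The part of \<open>f\<close> that the current radius already covers, between 0
    and 1/2 for a boundary arc. In these terms \<open>U x\<close> says that every boundary arc
    exceeds its threshold, and \<open>V x\<close> that \<open>e\<close> does so with the least
    overshoot.\<close>
  define a where "a x f = ( radius x h - dst x h (fst f))" for x :: "nat \<times> nat \<Rightarrow> real" and f :: "nat \<times> nat"
  define U where "U x = {y \<in> space (?P J). \<forall>f\<in>boundary n s h. a x f < y f}" for x
  define V where "V x = {y \<in> space (?P J). a x e < y e \<and>
    (\<forall>f\<in>boundary n s h - {e}. y e - a x e < y f - a x f)}" for x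
  have W: "weights n = ?P (I \<union> J)" using IJ by (simp add: weights_eq)
  have space: "merge I J (x, y) \<in> space (weights n)" if "x \<in> space (?P I)" "y \<in> space (?P J)" for x y
    using that unfolding W by (auto simp: space_PiM)
  have dst: "dst (merge I J (x, y)) h = dst x h" "radius (merge I J (x, y)) h = radius x h" for x y
    using hI IJ(1) by (intro dst_cong radius_cong; force simp: merge_def)+
  have set: "settled n s (merge I J (x, y)) h = settled n s x h" for x y
    using IJ(1) by (intro settled_cong hist) (auto simp: I_def merge_def)
  have mb: "merge I J (x, y) f = y f" if "f \<in> boundary n s h" for x y f
    using that bJ IJ(1) by (auto simp: merge_def)
  have eq: "merge I J (x, y) \<in> explored h \<longleftrightarrow> settled n s x h \<and> y \<in> U x"
    if "x \<in> space (?P I)" "y \<in> space (?P J)" for x y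
    using space[OF that] that(2)
    by (auto simp: explored_def explores_def dst set mb U_def a_def algebra_simps)
  \<comment> \<open>Only an inclusion: \<open>V x\<close> also admits weights for which the step
    would push the radius above 1/2.\<close>
  have le: "settled n s x h \<and> y \<in> V x"
    if "x \<in> space (?P I)" "y \<in> space (?P J)" "merge I J (x, y) \<in> explored (e # h)" for x y
  proof -
    have ex: "explores n s (merge I J (x, y)) (e # h)" using that by (simp add: explored_def)
    have "dst x h (fst e) + y e < dst x h (fst f) + y f" if "f \<in> boundary n s h" "f \<noteq> e" for f
      using explores_ConsD(2)[OF assms ex that] e that by (simp add: dst mb)
    moreover have "radius x h < dst x h (fst e) + y e"
      using explores_ConsD(3)[OF assms ex] e by (simp add: dst mb)
    moreover have "settled n s x h"
      using explores_ConsD(1)[OF assms ex] by (simp add: explores_def set)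
    ultimately show ?thesis using that(2) by (auto simp: V_def a_def algebra_simps)
  qed
  have "emeasure (weights n) (explored (e # h)) = (\<integral>\<^sup>+ w. indicator (explored (e # h)) w \<partial>weights n)"
    using sets_explored[OF assms] by simp
  also have "\<dots> = (\<integral>\<^sup>+ x. (\<integral>\<^sup>+ y. indicator (explored (e # h)) (merge I J (x, y)) \<partial>?P J) \<partial>?P I)"
    unfolding W using IJ sets_explored[OF assms]
    by (intro unif_product.product_nn_integral_fold) (auto simp: W)
  also have "\<dots> \<le> (\<integral>\<^sup>+ x. (ennreal (2 / card (boundary n s h)) *
      (\<integral>\<^sup>+ y. indicator (explored h) (merge I J (x, y)) \<partial>?P J)) \<partial>?P I)"
  proof (rule nn_integral_mono)
    fix x assume x: "x \<in> space (?P I)"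
    show "(\<integral>\<^sup>+ y. indicator (explored (e # h)) (merge I J (x, y)) \<partial>?P J)
      \<le> ennreal (2 / card (boundary n s h)) *
          (\<integral>\<^sup>+ y. indicator (explored h) (merge I J (x, y)) \<partial>?P J)"
    proof (cases "settled n s x h")
      case True
      have a: "0 \<le> a x f" "a x f \<le> 1 / 2" if "f \<in> boundary n s h" for f
        using that dst_bounds[OF hist True, of "fst f"] radius_bounds[OF hist True]
        by (auto simp: a_def boundary_def)
      have [measurable]: "(\<lambda>y. y f) \<in> borel_measurable (?P J)" if "f \<in> boundary n s h" for f
        using that bJ by (intro measurable_coordinate) auto
      have [measurable]: "(\<lambda>y. y e) \<in> borel_measurable (?P J)"
        using e bJ by (intro measurable_coordinate) auto
      have UV: "U x \<in> sets (?P J)" "V x \<in> sets (?P J)"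
        unfolding U_def V_def by measurable
      have "(\<integral>\<^sup>+ y. indicator (explored (e # h)) (merge I J (x, y)) \<partial>?P J)
        \<le> (\<integral>\<^sup>+ y. indicator (V x) y \<partial>?P J)"
        using le[OF x] by (intro nn_integral_mono) (auto simp: indicator_def)
      also have "\<dots> = emeasure (?P J) (V x)" using UV by simp
      also have "\<dots> \<le> ennreal (2 / card (boundary n s h)) * (\<Prod>f\<in>boundary n s h. ennreal (1 - a x f))"
        unfolding V_def using IJ bJ e a by (intro emeasure_first_above) auto
      also have "(\<Prod>f\<in>boundary n s h. ennreal (1 - a x f)) = emeasure (?P J) (U x)"
        unfolding U_def using IJ bJ a by (intro emeasure_all_above[symmetric]) auto
      also have "\<dots> = (\<integral>\<^sup>+ y. indicator (U x) y \<partial>?P J)" using UV by simp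
      also have "\<dots> = (\<integral>\<^sup>+ y. indicator (explored h) (merge I J (x, y)) \<partial>?P J)"
        using eq[OF x] True by (intro nn_integral_cong) (auto simp: indicator_def)
      finally show ?thesis by (simp add: mult_left_mono)
    next
      case False
      then have "(\<integral>\<^sup>+ y. indicator (explored (e # h)) (merge I J (x, y)) \<partial>?P J) = (\<integral>\<^sup>+ y. 0 \<partial>?P J)"
        using le[OF x] by (intro nn_integral_cong) (auto simp: indicator_def)
      then show ?thesis by simp
    qed
  qed
  also have "\<dots> = ennreal (2 / card (boundary n s h)) *
      (\<integral>\<^sup>+ x. (\<integral>\<^sup>+ y. indicator (explored h) (merge I J (x, y)) \<partial>?P J) \<partial>?P I)"
  proof (rule nn_integral_cmult)
    have [measurable]: "explored h \<in> sets (?P (I \<union> J))" using sets_explored[OF hist] W by simp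
    show "(\<lambda>x. \<integral>\<^sup>+ y. indicator (explored h) (merge I J (x, y)) \<partial>?P J) \<in> borel_measurable (?P I)"
      by measurable
  qed
  also have "(\<integral>\<^sup>+ x. (\<integral>\<^sup>+ y. indicator (explored h) (merge I J (x, y)) \<partial>?P J) \<partial>?P I)
      = (\<integral>\<^sup>+ w. indicator (explored h) w \<partial>weights n)"
    unfolding W using IJ sets_explored[OF hist]
    by (intro unif_product.product_nn_integral_fold[symmetric]) (auto simp: W)
  also have "\<dots> = emeasure (weights n) (explored h)" using sets_explored[OF hist] by simp
  finally show ?thesis .
qed

end

section \<open>Moments of the sum of squared child numbers\<close>

definition children :: "(nat \<times> nat) list \<Rightarrow> nat \<Rightarrow> nat" where
  "children h u = length (filter (\<lambda>e. fst e = u) h)"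

definition sq_children :: "nat \<Rightarrow> (nat \<times> nat) list \<Rightarrow> real" where
  "sq_children n h = (\<Sum>u<n. (real (children h u))\<^sup>2)"

text \<open>The conditional expectation of an increment of \<open>sq_children\<close> is at most \<open>6\<close>.\<close>

definition excess :: "nat \<Rightarrow> (nat \<times> nat) list \<Rightarrow> real" where
  "excess n h = max 0 (sq_children n h - 6 * length h)"

definition histories :: "nat \<Rightarrow> nat \<Rightarrow> nat \<Rightarrow> (nat \<times> nat) list set" where
  "histories n s t = {h. history n s h \<and> length h = t}"

lemma children_Cons: "children (e # h) u = children h u + (if fst e = u then 1 else 0)"
  by (simp add: children_def)

lemma sq_children_nonneg: "0 \<le> sq_children n h"
  by (simp add: sq_children_def sum_nonneg)

lemma sq_children_Cons:
  assumes "fst e < n"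
  shows "sq_children n (e # h) = sq_children n h + (2 * real (children h (fst e)) + 1)"
proof -
  have "(real (children (e # h) u))\<^sup>2 =
      (real (children h u))\<^sup>2 + (if u = fst e then 2 * real (children h (fst e)) + 1 else 0)" for u
    by (simp add: children_Cons power2_eq_square algebra_simps)
  then show ?thesis using assms by (simp add: sq_children_def sum.distrib)
qed

context search
begin

interpretation prob_space "weights n"
  by (rule prob_space_weights)

lemma finite_histories: "finite (histories n s t)"
  by (rule finite_subset[OF _ finite_lists_length_eq[OF finite_arcs_Kn[of n], of t]])
     (use set_history(1) in \<open>auto simp: histories_def\<close>)

lemma histories_0: "histories n s 0 = {[]}"
  by (auto simp: histories_def)

lemma sum_histories_Suc:
  "(\<Sum>h\<in>histories n s (Suc t). F h) = (\<Sum>h\<in>histories n s t. \<Sum>e\<in>boundary n s h. F (e # h))"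
proof -
  have "histories n s (Suc t) = (\<lambda>(h, e). e # h) ` (SIGMA h:histories n s t. boundary n s h)"
    by (auto simp: histories_def image_iff length_Suc_conv)
  moreover have "inj_on (\<lambda>(h, e). e # h) (SIGMA h:histories n s t. boundary n s h)"
    by (auto intro: inj_onI)
  ultimately show ?thesis
    using finite_histories by (simp add: sum.reindex sum.Sigma o_def case_prod_unfold)
qed

lemma children_outside: "history n s h \<Longrightarrow> u \<notin> reached s h \<Longrightarrow> children h u = 0"
  using set_history(2)[of h] by (fastforce simp: children_def filter_empty_conv)

lemma sum_children:
  assumes "history n s h"
  shows "(\<Sum>u\<in>reached s h. real (children h u)) = length h"
  using assms
proof (induction h)
  case (Cons e h)
  then have e: "fst e \<in> reached s h" "snd e \<notin> reached s h" by (auto simp: boundary_def)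
  then have "fst e \<noteq> snd e" by auto
  have "real (children (e # h) u) = real (children h u) + (if u = fst e then 1 else 0)" for u
    by (simp add: children_Cons)
  with e Cons children_outside[of h "snd e"] \<open>fst e \<noteq> snd e\<close> show ?case
    by (simp add: sum.distrib)
qed (simp add: children_def)

lemma sum_children_sq:
  assumes "history n s h"
  shows "(\<Sum>u\<in>reached s h. (real (children h u))\<^sup>2) = sq_children n h"
  unfolding sq_children_def
  using reached_less[OF assms] children_outside[OF assms] by (intro sum.mono_neutral_left) auto

text \<open>Every reached vertex is the tail of equally many boundary arcs, one for each unreached
  vertex. So a uniform boundary arc has a uniform reached tail.\<close>

lemma sum_boundary:
  assumes "history n s h"
  shows "(\<Sum>e\<in>boundary n s h. \<phi> (fst e)) = real (n - Suc (length h)) * (\<Sum>u\<in>reached s h. \<phi> u)"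
proof -
  have "(\<Sum>e\<in>boundary n s h. \<phi> (fst e)) = (\<Sum>(u, x)\<in>reached s h \<times> ({..<n} - reached s h). \<phi> u)"
    by (simp add: boundary_def case_prod_unfold)
  also have "\<dots> = (\<Sum>u\<in>reached s h. \<Sum>x\<in>{..<n} - reached s h. \<phi> u)"
    by (rule sum.cartesian_product[symmetric])
  also have "\<dots> = real (n - Suc (length h)) * (\<Sum>u\<in>reached s h. \<phi> u)"
    using reached_less[OF assms] card_reached[OF assms]
    by (simp add: card_Diff_subset sum_distrib_left)
  finally show ?thesis .
qed

section \<open>Expectations over explored histories\<close>

lemma prob_explored_Cons:
  assumes "history n s (e # h)"
  shows "prob (explored (e # h)) \<le> 2 / card (boundary n s h) * prob (explored h)"
  using emeasure_explored_Cons[OF assms]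
  by (simp add: emeasure_eq_measure ennreal_mult[symmetric])

text \<open>The events for different next arcs are disjoint parts of the event for \<open>h\<close>.
  The inequality accounts for explorations that stop at \<open>h\<close>.\<close>

lemma sum_prob_explored_Cons:
  assumes "history n s h"
  shows "(\<Sum>e\<in>boundary n s h. prob (explored (e # h))) \<le> prob (explored h)"
proof -
  have "disjoint_family_on (\<lambda>e. explored (e # h)) (boundary n s h)"
    using explores_disjoint assms by (fastforce simp: disjoint_family_on_def explored_def)
  moreover have "(\<lambda>e. explored (e # h)) ` boundary n s h \<subseteq> events"
    using sets_explored assms by auto
  ultimately have "(\<Sum>e\<in>boundary n s h. prob (explored (e # h)))
      = prob (\<Union>e\<in>boundary n s h. explored (e # h))"
    by (intro finite_measure_finite_Union[symmetric]) auto
  also have "\<dots> \<le> prob (explored h)"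
    using explores_ConsD(1) assms sets_explored[OF assms]
    by (intro finite_measure_mono) (auto simp: explored_def)
  finally show ?thesis .
qed

lemma sum_prob_histories_le: "(\<Sum>h\<in>histories n s t. prob (explored h)) \<le> 1"
proof (induction t)
  case (Suc t)
  have "(\<Sum>h\<in>histories n s (Suc t). prob (explored h)) \<le> (\<Sum>h\<in>histories n s t. prob (explored h))"
    unfolding sum_histories_Suc
    by (intro sum_mono sum_prob_explored_Cons) (simp add: histories_def)
  with Suc show ?case by simp
qed (simp add: histories_0)

text \<open>The next parent is distributed like a uniformly random reached vertex, up to the factor
  \<open>2\<close>; the constant part \<open>b\<close> does not suffer from this factor.\<close>

lemma one_step:
  assumes hist: "history n s h" and less: "Suc (length h) < n"
    and b: "0 \<le> b" and \<phi>: "\<And>u. 0 \<le> \<phi> u"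
  shows "(\<Sum>e\<in>boundary n s h. prob (explored (e # h)) * (b + \<phi> (fst e)))
    \<le> prob (explored h) * (b + 2 / Suc (length h) * (\<Sum>u\<in>reached s h. \<phi> u))"
proof -
  let ?B = "boundary n s h"
  have "(\<Sum>e\<in>?B. prob (explored (e # h)) * (b + \<phi> (fst e)))
      = b * (\<Sum>e\<in>?B. prob (explored (e # h))) + (\<Sum>e\<in>?B. prob (explored (e # h)) * \<phi> (fst e))"
    by (simp add: algebra_simps sum.distrib sum_distrib_left)
  also have "\<dots> \<le> b * prob (explored h)
      + (\<Sum>e\<in>?B. (2 / card ?B * prob (explored h)) * \<phi> (fst e))"
    using b \<phi> hist
    by (intro add_mono mult_left_mono sum_mono mult_right_mono sum_prob_explored_Cons prob_explored_Cons) auto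
  also have "(\<Sum>e\<in>?B. (2 / card ?B * prob (explored h)) * \<phi> (fst e))
      = prob (explored h) * (2 / Suc (length h) * (\<Sum>u\<in>reached s h. \<phi> u))"
  proof -
    \<comment> \<open>The number of unreached vertices, which cancels between
      \<open>sum_boundary\<close> and \<open>card_boundary\<close>.\<close>
    define m where "m = n - Suc (length h)"
    have "real m \<noteq> 0" using less by (simp add: m_def)
    then show ?thesis
      unfolding sum_distrib_left[symmetric] sum_boundary[OF hist] card_boundary[OF hist] m_def[symmetric]
      by (simp add: divide_simps del: of_nat_Suc mult_Suc)
  qed
  finally show ?thesis by (simp add: algebra_simps)
qed

text \<open>By \<open>sq_children_Cons\<close>, \<open>2 * children h u + 1\<close> is what a
  further child of \<open>u\<close> adds to \<open>sq_children\<close>. These are the first two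
  moments of the increment under a uniform parent, before division by the number of reached
  vertices.\<close>

lemma sum_increments:
  assumes "history n s h"
  shows "(\<Sum>u\<in>reached s h. 2 * real (children h u) + 1) = 2 * length h + Suc (length h)"
    and "(\<Sum>u\<in>reached s h. (2 * real (children h u) + 1)\<^sup>2)
      = 4 * sq_children n h + 4 * length h + Suc (length h)"
proof -
  show "(\<Sum>u\<in>reached s h. 2 * real (children h u) + 1) = 2 * length h + Suc (length h)"
    using sum_children[OF assms] card_reached[OF assms]
    by (simp add: sum.distrib sum_distrib_left[symmetric])
  have "(2 * real (children h u) + 1)\<^sup>2 = 4 * (real (children h u))\<^sup>2 + 4 * real (children h u) + 1" for u
    by (simp add: power2_eq_square algebra_simps)
  then show "(\<Sum>u\<in>reached s h. (2 * real (children h u) + 1)\<^sup>2)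
      = 4 * sq_children n h + 4 * length h + Suc (length h)"
    using sum_children[OF assms] sum_children_sq[OF assms] card_reached[OF assms]
    by (simp add: sum.distrib sum_distrib_left[symmetric])
qed

text \<open>Such sums are expectations restricted to explorations that survive \<open>t\<close>
  steps. The conditional mean of an increment is at most \<open>2 / (t + 1) * (3 * t + 1)\<close>,
  hence at most 6.\<close>

lemma mean_sq_children:
  assumes "t < n"
  shows "(\<Sum>h\<in>histories n s t. prob (explored h) * sq_children n h) \<le> 6 * t"
  using assms
proof (induction t)
  case 0
  show ?case by (simp add: histories_0 sq_children_def children_def)
next
  case (Suc t)
  have "(\<Sum>h\<in>histories n s (Suc t). prob (explored h) * sq_children n h)
      = (\<Sum>h\<in>histories n s t. \<Sum>e\<in>boundary n s h. prob (explored (e # h)) *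
          (sq_children n h + (2 * real (children h (fst e)) + 1)))"
    unfolding sum_histories_Suc
  proof (intro sum.cong refl)
    fix h e assume "h \<in> histories n s t" "e \<in> boundary n s h"
    then have "fst e < n" using reached_less[of h] by (auto simp: histories_def boundary_def)
    then show "prob (explored (e # h)) * sq_children n (e # h) =
      prob (explored (e # h)) * (sq_children n h + (2 * real (children h (fst e)) + 1))"
      by (simp add: sq_children_Cons)
  qed
  also have "\<dots> \<le> (\<Sum>h\<in>histories n s t. prob (explored h) * (sq_children n h + 6))"
  proof (rule sum_mono)
    fix h assume "h \<in> histories n s t"
    then have h: "history n s h" "length h = t" by (auto simp: histories_def)
    have "(\<Sum>e\<in>boundary n s h. prob (explored (e # h)) *
          (sq_children n h + (2 * real (children h (fst e)) + 1)))
      \<le> prob (explored h) * (sq_children n h + 2 / Suc t * (2 * t + Suc t))"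
      using one_step[OF h(1), of "sq_children n h" "\<lambda>u. 2 * real (children h u) + 1"] h Suc.prems
      by (simp add: sq_children_nonneg sum_increments(1))
    also have "\<dots> \<le> prob (explored h) * (sq_children n h + 6)"
      by (intro mult_left_mono add_left_mono) (auto simp: field_simps)
    finally show "(\<Sum>e\<in>boundary n s h. prob (explored (e # h)) *
          (sq_children n h + (2 * real (children h (fst e)) + 1)))
      \<le> prob (explored h) * (sq_children n h + 6)" .
  qed
  also have "\<dots> = (\<Sum>h\<in>histories n s t. prob (explored h) * sq_children n h)
      + 6 * (\<Sum>h\<in>histories n s t. prob (explored h))"
    by (simp add: algebra_simps sum.distrib sum_distrib_left)
  also have "\<dots> \<le> 6 * real t + 6 * 1"
    using Suc sum_prob_histories_le by (intro add_mono mult_left_mono) auto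
  finally show ?case by simp
qed

text \<open>Let \<open>b\<close> be the excess after the allowance of 6 for the next step is taken
  off, cut at 0. The new excess is at most \<open>b\<close> plus the increment. The cross term has
  conditional mean at most \<open>12 * b\<close>; if \<open>b\<close> is positive, the old excess is
  \<open>b + 6\<close>, whose square absorbs it. Only the second moment of the increment remains,
  and this is controlled on average by \<open>mean_sq_children\<close>.\<close>

lemma second_moment_excess:
  assumes "t < n"
  shows "(\<Sum>h\<in>histories n s t. prob (explored h) * (excess n h)\<^sup>2) \<le> 58 * t"
  using assms
proof (induction t)
  case 0
  show ?case by (simp add: histories_0 excess_def sq_children_def children_def)
next
  case (Suc t)
  have "(\<Sum>h\<in>histories n s (Suc t). prob (explored h) * (excess n h)\<^sup>2)
      \<le> (\<Sum>h\<in>histories n s t. prob (explored h) * ((excess n h)\<^sup>2 + (8 / Suc t * sq_children n h + 10)))"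
    unfolding sum_histories_Suc
  proof (rule sum_mono)
    fix h assume "h \<in> histories n s t"
    then have h: "history n s h" "length h = t" by (auto simp: histories_def)
    define b where "b = max 0 (sq_children n h - 6 * Suc t)"
    define \<delta> where "\<delta> u = 2 * real (children h u) + 1" for u
    have b: "0 \<le> b" and \<delta>: "0 \<le> \<delta> u" for u by (auto simp: b_def \<delta>_def)
    have "(\<Sum>e\<in>boundary n s h. prob (explored (e # h)) * (excess n (e # h))\<^sup>2)
        \<le> (\<Sum>e\<in>boundary n s h. prob (explored (e # h)) * (b\<^sup>2 + (2 * b * \<delta> (fst e) + (\<delta> (fst e))\<^sup>2)))"
    proof (intro sum_mono mult_left_mono)
      fix e assume "e \<in> boundary n s h"
      then have "fst e < n" using reached_less[OF h(1)] by (auto simp: boundary_def)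
      then have "excess n (e # h) \<le> b + \<delta> (fst e)"
        using \<delta>[of "fst e"] b h(2) by (simp add: excess_def b_def sq_children_Cons \<delta>_def)
      then have "(excess n (e # h))\<^sup>2 \<le> (b + \<delta> (fst e))\<^sup>2"
        by (intro power_mono) (auto simp: excess_def)
      then show "(excess n (e # h))\<^sup>2 \<le> b\<^sup>2 + (2 * b * \<delta> (fst e) + (\<delta> (fst e))\<^sup>2)"
        by (simp add: power2_eq_square algebra_simps)
    qed auto
    also have "\<dots> \<le> prob (explored h) * (b\<^sup>2 + 2 / Suc (length h) *
        (\<Sum>u\<in>reached s h. 2 * b * \<delta> u + (\<delta> u)\<^sup>2))"
      using h Suc.prems b \<delta> by (intro one_step) auto
    also have "\<dots> \<le> prob (explored h) * ((excess n h)\<^sup>2 + (8 / Suc t * sq_children n h + 10))"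
    proof (intro mult_left_mono)
      have "(\<Sum>u\<in>reached s h. 2 * b * \<delta> u + (\<delta> u)\<^sup>2)
          = 2 * b * (2 * t + Suc t) + (4 * sq_children n h + 4 * t + Suc t)"
        using sum_increments[OF h(1)] h(2)
        by (simp add: \<delta>_def sum.distrib sum_distrib_left[symmetric])
      also have "2 / Suc t * \<dots> \<le> 12 * b + (8 / Suc t * sq_children n h + 10)"
        using b by (simp add: field_simps)
      finally have "2 / Suc t * (\<Sum>u\<in>reached s h. 2 * b * \<delta> u + (\<delta> u)\<^sup>2)
        \<le> 12 * b + (8 / Suc t * sq_children n h + 10)" .
      moreover have "b\<^sup>2 + 12 * b \<le> (excess n h)\<^sup>2"
      proof (cases "b = 0")
        case False
        then have "excess n h = b + 6" using h(2) by (auto simp: b_def excess_def max_def split: if_splits)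
        then show ?thesis by (simp add: power2_eq_square algebra_simps)
      qed simp
      ultimately show "b\<^sup>2 + 2 / Suc (length h) * (\<Sum>u\<in>reached s h. 2 * b * \<delta> u + (\<delta> u)\<^sup>2)
        \<le> (excess n h)\<^sup>2 + (8 / Suc t * sq_children n h + 10)"
        using h(2) by simp
    qed auto
    finally show "(\<Sum>e\<in>boundary n s h. prob (explored (e # h)) * (excess n (e # h))\<^sup>2)
      \<le> prob (explored h) * ((excess n h)\<^sup>2 + (8 / Suc t * sq_children n h + 10))" .
  qed
  also have "\<dots> = (\<Sum>h\<in>histories n s t. prob (explored h) * (excess n h)\<^sup>2)
      + (8 / Suc t * (\<Sum>h\<in>histories n s t. prob (explored h) * sq_children n h)
      + 10 * (\<Sum>h\<in>histories n s t. prob (explored h)))"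
    by (simp add: algebra_simps sum.distrib sum_distrib_left)
  also have "\<dots> \<le> 58 * real t + (8 / Suc t * (6 * real t) + 10 * 1)"
    using Suc sum_prob_histories_le mean_sq_children[of t]
    by (intro add_mono mult_left_mono) auto
  \<comment> \<open>The first summand in parentheses is at most 8 * 6 = 48, and 48 + 10 =
    58.\<close>
  also have "\<dots> \<le> 58 * Suc t" by (simp add: field_simps)
  finally show ?case by simp
qed

text \<open>By \<open>explores_disjoint\<close> at most one history of full length is explored, so
  this is its squared excess, or 0 if the exploration stopped early. The form of a finite sum lets
  measurability and the integral be treated term by term.\<close>

definition sq_excess :: "(nat \<times> nat \<Rightarrow> real) \<Rightarrow> real" where
  "sq_excess w = (\<Sum>h\<in>histories n s (n - 1). indicator (explored h) w * (excess n h)\<^sup>2)"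

lemma nn_integral_sq_excess:
  "(\<integral>\<^sup>+ w. ennreal (sq_excess w) \<partial>weights n) \<le> ennreal (58 * real n)"
proof -
  have ev: "explored h \<in> events" if "h \<in> histories n s (n - 1)" for h
    using that by (intro sets_explored) (simp add: histories_def)
  have "(\<integral>\<^sup>+ w. ennreal (sq_excess w) \<partial>weights n)
      = (\<integral>\<^sup>+ w. (\<Sum>h\<in>histories n s (n - 1). indicator (explored h) w * ennreal ((excess n h)\<^sup>2)) \<partial>weights n)"
    by (intro nn_integral_cong)
       (auto simp: sq_excess_def sum_ennreal[symmetric] ennreal_mult ennreal_indicator)
  also have "\<dots> = (\<Sum>h\<in>histories n s (n - 1). (\<integral>\<^sup>+ w. indicator (explored h) w * ennreal ((excess n h)\<^sup>2) \<partial>weights n))"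
    using ev by (intro nn_integral_sum) auto
  also have "\<dots> = (\<Sum>h\<in>histories n s (n - 1). ennreal (prob (explored h) * (excess n h)\<^sup>2))"
    using ev by (intro sum.cong refl)
      (simp add: nn_integral_multc emeasure_eq_measure ennreal_mult)
  also have "\<dots> = ennreal (\<Sum>h\<in>histories n s (n - 1). prob (explored h) * (excess n h)\<^sup>2)"
    by (intro sum_ennreal) auto
  also have "\<dots> \<le> ennreal (58 * real n)"
    using second_moment_excess[of "n - 1"] root by (intro ennreal_leI) auto
  finally show ?thesis .
qed

lemma measurable_sq_excess: "sq_excess \<in> borel_measurable (weights n)"
  unfolding sq_excess_def using sets_explored
  by (intro borel_measurable_sum borel_measurable_times borel_measurable_indicator)
     (auto simp: histories_def)

end

section \<open>Almost sure uniqueness and short distances\<close>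

text \<open>With the other coordinates fixed, \<open>w e\<close> would have to hit a single point,
  and the uniform distribution has no atoms.\<close>

lemma AE_coordinate_neq:
  fixes g :: "('i \<Rightarrow> real) \<Rightarrow> real"
  assumes J: "finite J" "e \<in> J" and g [measurable]: "g \<in> borel_measurable (PiM J (\<lambda>_. unif))"
    and indep: "\<And>w y. g (w(e := y)) = g w"
  shows "AE w in PiM J (\<lambda>_. unif). w e \<noteq> g w"
proof -
  define J' where "J' = J - {e}"
  have J': "finite J'" "e \<notin> J'" "J = insert e J'" using J by (auto simp: J'_def)
  let ?P = "\<lambda>J. PiM J (\<lambda>_::'i. unif)"
  define N where "N = {w \<in> space (?P J). w e = g w}"
  note [measurable] = measurable_coordinate[OF J(2)]
  have N: "N \<in> sets (?P J)" unfolding N_def by measurable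
  then have "emeasure (?P J) N = (\<integral>\<^sup>+ w. indicator N w \<partial>?P J)" by simp
  also have "\<dots> = (\<integral>\<^sup>+ x. (\<integral>\<^sup>+ y. indicator N (x(e := y)) \<partial>unif) \<partial>?P J')"
    unfolding J'(3) using J' N by (intro unif_product.product_nn_integral_insert) auto
  also have "\<dots> \<le> (\<integral>\<^sup>+ x. (\<integral>\<^sup>+ y. indicator {g x} y \<partial>unif) \<partial>?P J')"
    using indep by (intro nn_integral_mono) (auto simp: N_def indicator_def)
  also have "\<dots> = 0"
  proof -
    have "emeasure lborel ({0..1} \<inter> {c}) = 0" for c :: real
      by (rule emeasure_lborel_countable) simp
    then show ?thesis by simp
  qed
  finally have "N \<in> null_sets (?P J)" using N by auto
  then show ?thesis by (rule AE_I') (auto simp: N_def)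
qed

lemma AE_weights_pos: "AE w in weights n. \<forall>e\<in>arcs (Kn n). 0 < w e"
proof (rule AE_finite_allI)
  fix e assume e: "e \<in> arcs (Kn n)"
  have "AE x in unif. x \<in> {0..1}"
    by (intro AE_uniform_measureI) auto
  moreover have "AE x in unif. x \<noteq> 0"
    by (rule AE_uniform_measureI) (use AE_lborel_singleton[of "0 :: real"] in \<open>simp_all add: eventually_mono\<close>)
  ultimately have "AE x in unif. 0 < x" by eventually_elim auto
  then show "AE w in weights n. 0 < w e"
    unfolding weights_eq using e prob_space_unif by (intro AE_PiM_component)
qed simp

text \<open>A tie prescribes \<open>w e\<close> in terms of other weights: \<open>e\<close> differs
  from \<open>f\<close>, and it is not in \<open>h\<close> because its head is unreached.\<close>

lemma (in search) AE_tie_free: "AE w in weights n. tie_free w"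
proof -
  have fin: "finite {h. history n s h}"
    by (rule finite_subset[OF _ finite_lists_length_le[OF finite_arcs_Kn[of n], of n]])
       (use set_history(1) length_history in \<open>fastforce\<close>)
  have "AE w in weights n. \<forall>h\<in>{h. history n s h}. \<forall>e\<in>boundary n s h. \<forall>f\<in>boundary n s h - {e}.
     dst w h (fst e) + w e \<noteq> dst w h (fst f) + w f"
  proof (intro AE_finite_allI fin finite_boundary finite_Diff)
    fix h e f assume h: "h \<in> {h. history n s h}" and e: "e \<in> boundary n s h"
      and f: "f \<in> boundary n s h - {e}"
    then have hist: "history n s h" and fe: "f \<in> boundary n s h" by auto
    define g where "g w = dst w h (fst f) + w f - dst w h (fst e)" for w
    have "AE w in PiM (arcs (Kn n)) (\<lambda>_. unif). w e \<noteq> g w"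
    proof (rule AE_coordinate_neq)
      show "e \<in> arcs (Kn n)" using boundary_subset_arcs[OF hist] e by auto
      note [measurable] = measurable_dst[OF set_history(1)[OF hist]]
        measurable_weight[OF fe hist, unfolded weights_eq]
      show "g \<in> borel_measurable (PiM (arcs (Kn n)) (\<lambda>_. unif))"
        unfolding g_def by measurable
      have "e \<notin> set h" using set_history(2)[OF hist, of "fst e" "snd e"] e by (auto simp: boundary_def)
      then have "dst (w(e := y)) h = dst w h" for w y by (intro dst_cong) auto
      then show "g (w(e := y)) = g w" for w y using f by (simp add: g_def)
    qed simp
    then show "AE w in weights n. dst w h (fst e) + w e \<noteq> dst w h (fst f) + w f"
      unfolding weights_eq by eventually_elim (simp add: g_def)
  qed
  then show ?thesis
    by eventually_elim (auto simp: tie_free_def)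
qed

text \<open>Two arcs of weight at most 1/4 stay within 1/2, the radius at which the exploration
  stops.\<close>

definition no_short_two_hop :: "nat \<Rightarrow> nat \<Rightarrow> nat \<Rightarrow> (nat \<times> nat \<Rightarrow> real) set" where
  "no_short_two_hop n s y = {w \<in> space (weights n). \<forall>z\<in>{..<n} - {s, y}.
     w (s, z) \<le> 1 / 4 \<longrightarrow> 1 / 4 < w (z, y)}"

lemma sets_no_short_two_hop:
  assumes "s < n" "y < n"
  shows "no_short_two_hop n s y \<in> sets (weights n)"
proof -
  have [measurable]: "(\<lambda>w. w (s, z)) \<in> borel_measurable (weights n)"
    "(\<lambda>w. w (z, y)) \<in> borel_measurable (weights n)" if "z \<in> {..<n} - {s, y}" for z
    using that assms unfolding weights_eq by (auto intro!: measurable_coordinate)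
  show ?thesis unfolding no_short_two_hop_def by measurable
qed

text \<open>The \<open>n - 2\<close> paths with two arcs from \<open>s\<close> to \<open>y\<close>
  share no arcs, hence are independent, and each has both arcs short with probability 1/16. The arcs
  out of \<open>s\<close> are integrated last.\<close>

lemma emeasure_no_short_two_hop:
  assumes sy: "s < n" "y < n" "s \<noteq> y"
  shows "emeasure (weights n) (no_short_two_hop n s y) = ennreal ((15 / 16) ^ (n - 2))"
proof -
  define Z where "Z = {..<n} - {s, y}"
  define I where "I = Pair s ` Z"
  define J where "J = arcs (Kn n) - I"
  have IJ: "finite I" "finite J" "I \<inter> J = {}" "I \<union> J = arcs (Kn n)"
    using sy by (auto simp: I_def J_def Z_def)
  have zy: "(z, y) \<in> J" if "z \<in> Z" for z using that sy by (auto simp: J_def I_def Z_def)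
  let ?P = "\<lambda>J. PiM J (\<lambda>_::nat \<times> nat. unif)"
  let ?N = "no_short_two_hop n s y"
  have W: "weights n = ?P (I \<union> J)" using IJ by (simp add: weights_eq)
  have N: "?N \<in> sets (?P (I \<union> J))" using sets_no_short_two_hop sy W by metis
  \<comment> \<open>The conditional probability that an intermediate vertex fails, given the weight
    \<open>x\<close> of the arc that leads to it.\<close>
  define q :: "real \<Rightarrow> ennreal" where "q x = (if x \<le> 1 / 4 then ennreal (3 / 4) else 1)" for x
  have q [measurable]: "q \<in> borel_measurable borel" unfolding q_def by measurable
  have inner: "(\<integral>\<^sup>+ v. indicator ?N (merge I J (x, v)) \<partial>?P J) = (\<Prod>f\<in>I. q (x f))"
    if x: "x \<in> space (?P I)" for x
  proof -
    define B where "B = {z \<in> Z. x (s, z) \<le> 1 / 4}"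
    let ?U = "{v \<in> space (?P J). \<forall>f\<in>(\<lambda>z. (z, y)) ` B. 1 / 4 < v f}"
    have finB: "finite B" "B \<subseteq> Z" by (auto simp: B_def Z_def)
    have mI: "merge I J (x, v) (s, z) = x (s, z)" and mJ: "merge I J (x, v) (z, y) = v (z, y)"
      if "z \<in> Z" for z v using that zy[OF that] IJ(3) by (auto simp: I_def merge_def)
    have "merge I J (x, v) \<in> ?N \<longleftrightarrow> v \<in> ?U" if v: "v \<in> space (?P J)" for v
    proof -
      have "merge I J (x, v) \<in> space (weights n)"
        using x v unfolding W by (auto simp: space_PiM)
      then show ?thesis using v mI mJ
        by (auto simp: no_short_two_hop_def Z_def[symmetric] B_def)
    qed
    then have "(\<integral>\<^sup>+ v. indicator ?N (merge I J (x, v)) \<partial>?P J) = (\<integral>\<^sup>+ v. indicator ?U v \<partial>?P J)"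
      by (intro nn_integral_cong) (auto simp: indicator_def)
    also have "\<dots> = emeasure (?P J) ?U"
    proof (rule nn_integral_indicator)
      have [measurable]: "(\<lambda>v. v f) \<in> borel_measurable (?P J)" if "f \<in> (\<lambda>z. (z, y)) ` B" for f
        using that zy finB by (intro measurable_coordinate) auto
      show "?U \<in> sets (?P J)" using finB by measurable
    qed
    also have "\<dots> = (\<Prod>f\<in>(\<lambda>z. (z, y)) ` B. ennreal (1 - 1 / 4))"
      using IJ zy finB by (intro emeasure_all_above) auto
    also have "\<dots> = (\<Prod>z\<in>B. ennreal (3 / 4))"
      by (subst prod.reindex) (auto intro: inj_onI)
    also have "\<dots> = (\<Prod>z\<in>Z. q (x (s, z)))"
      using finB(2) by (intro prod.mono_neutral_cong_left) (auto simp: B_def q_def Z_def)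
    also have "\<dots> = (\<Prod>f\<in>I. q (x f))"
      unfolding I_def by (subst prod.reindex) (auto intro: inj_onI)
    finally show ?thesis .
  qed
  have "emeasure (weights n) ?N = (\<integral>\<^sup>+ w. indicator ?N w \<partial>?P (I \<union> J))"
    using N W by simp
  also have "\<dots> = (\<integral>\<^sup>+ x. (\<integral>\<^sup>+ v. indicator ?N (merge I J (x, v)) \<partial>?P J) \<partial>?P I)"
    using IJ N by (intro unif_product.product_nn_integral_fold) auto
  also have "\<dots> = (\<integral>\<^sup>+ x. (\<Prod>f\<in>I. q (x f)) \<partial>?P I)"
    using inner by (intro nn_integral_cong)
  also have "\<dots> = (\<Prod>f\<in>I. \<integral>\<^sup>+ x. q x \<partial>unif)"
    using IJ(1) q by (intro unif_product.product_nn_integral_prod) (simp_all cong: measurable_cong_sets)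
  also have "(\<integral>\<^sup>+ x. q x \<partial>unif) = ennreal (15 / 16)"
  proof -
    have "(\<integral>\<^sup>+ x. q x \<partial>unif) = (\<integral>\<^sup>+ x. ennreal (3 / 4) * indicator {..1 / 4} x + indicator {1 / 4<..} x \<partial>unif)"
      by (intro nn_integral_cong) (auto simp: q_def)
    also have "\<dots> = ennreal (3 / 4) * emeasure unif {..1 / 4} + emeasure unif {1 / 4<..}"
      by (simp add: nn_integral_add nn_integral_cmult)
    also have "\<dots> = ennreal (3 / 4 * (1 / 4) + (1 - 1 / 4))"
      by (subst emeasure_unif_atMost emeasure_unif_greaterThan; simp)+
         (simp add: ennreal_mult[symmetric] ennreal_plus[symmetric] del: ennreal_plus)
    finally show ?thesis by simp
  qed
  also have "(\<Prod>f\<in>I. ennreal (15 / 16)) = ennreal ((15 / 16) ^ (n - 2))"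
  proof -
    have "card I = n - 2"
      unfolding I_def Z_def using sy by (subst card_image) (auto intro: inj_onI simp: card_Diff_subset)
    then show ?thesis by (simp add: ennreal_power)
  qed
  finally show ?thesis .
qed

section \<open>Locally shortest paths and trees of shortest paths\<close>

text \<open>The weights of the reversed graph. The restriction to arcs keeps the function in the
  space of the product measure, whose elements are \<open>undefined\<close> elsewhere.\<close>

definition flip :: "nat \<Rightarrow> (nat \<times> nat \<Rightarrow> real) \<Rightarrow> nat \<times> nat \<Rightarrow> real" where
  "flip n w = (\<lambda>e\<in>arcs (Kn n). w (prod.swap e))"

lemma apath_Kn_reverse:
  assumes "pre_digraph.apath (Kn n) u p v"
  shows "pre_digraph.apath (Kn n) v (rev (map prod.swap p)) u"
proof -
  interpret graph "Kn n" by (rule graph_Kn)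
  have "awalk v (rev (map prod.swap p)) u \<and> awalk_verts v (rev (map prod.swap p)) = rev (awalk_verts u p)"
    if "awalk u p v" for p
    using that
  proof (induction p arbitrary: u)
    case Nil
    then show ?case by (simp add: awalk_Nil_iff)
  next
    case (Cons e p)
    then have e: "e \<in> arcs (Kn n)" "u = fst e" and walk: "awalk (snd e) p v"
      by (auto simp: awalk_Cons_iff)
    from Cons.IH[OF walk] have IH: "awalk v (rev (map prod.swap p)) (snd e)"
      "awalk_verts v (rev (map prod.swap p)) = rev (awalk_verts (snd e) p)" by auto
    have arc: "awalk (snd e) [prod.swap e] (fst e)"
      using e by (cases e) (auto simp: awalk_def)
    have walk': "awalk v (rev (map prod.swap p) @ [prod.swap e]) (fst e)"
      by (rule awalk_appendI[OF IH(1) arc])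
    have "awalk_verts v (rev (map prod.swap p) @ [prod.swap e])
        = awalk_verts v (rev (map prod.swap p)) @ tl (awalk_verts (snd e) [prod.swap e])"
      using awalk_verts_append[OF walk'] IH(1) by auto
    then show ?case using walk' IH(2) e by simp
  qed
  then show ?thesis using assms by (auto simp: apath_def)
qed

context search
begin

section \<open>Optimality and uniqueness of the tree paths\<close>

context
  fixes w h
  assumes hist: "history n s h" and full: "Suc (length h) = n" and settled: "settled n s w h"
    and pos: "\<And>e. e \<in> arcs (Kn n) \<Longrightarrow> 0 < w e"
begin

interpretation graph "Kn n" by (rule graph_Kn)

lemma dst_arc:
  assumes "e \<in> arcs (Kn n)"
  shows "dst w h (snd e) \<le> dst w h (fst e) + w e"
    and "dst w h (fst e) + w e \<le> dst w h (snd e) \<Longrightarrow> e \<in> set h"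
  using settled_arc[OF hist settled pos, of "fst e" "snd e"] reached_all[OF hist full] assms
  by (cases e; cases "e \<in> set h"; force)+

text \<open>\<open>dst\<close> is a feasible potential that vanishes at the root, so the arc
  inequalities telescope along the walk.\<close>

lemma dst_le_cost:
  assumes "awalk s p v"
  shows "dst w h v \<le> awalk_cost w p"
  using assms
proof (induction p arbitrary: v rule: rev_induct)
  case Nil
  then show ?case using dst_root[OF hist] by (simp add: awalk_Nil_iff)
next
  case (snoc e p)
  then have "awalk s p (fst e)" "e \<in> arcs (Kn n)" "v = snd e"
    by (auto simp: awalk_simps)
  then show ?case using snoc.IH dst_arc(1)[of e] by fastforce
qed

text \<open>An optimal walk leaves no room for slack: its last arc is tight, hence a tree arc, and
  the rest of it is optimal again.\<close>

lemma optimal_snoc: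
  assumes "awalk s (p @ [e]) v" "awalk_cost w (p @ [e]) \<le> dst w h v"
  shows "e \<in> set h" "awalk s p (fst e)" "awalk_cost w p \<le> dst w h (fst e)" "v = snd e"
proof -
  have *: "awalk s p (fst e)" "e \<in> arcs (Kn n)" "v = snd e"
    using assms(1) by (auto simp: awalk_simps)
  then show "awalk s p (fst e)" "v = snd e" by auto
  show "e \<in> set h" "awalk_cost w p \<le> dst w h (fst e)"
    using dst_arc[of e] dst_le_cost[OF *(1)] * assms(2) by auto
qed

text \<open>Read backwards, both walks must follow the unique tree arc into each vertex. As no tree
  arc enters the root, both end there simultaneously.\<close>

lemma optimal_unique:
  assumes "awalk s p v" "awalk_cost w p \<le> dst w h v"
    and "awalk s q v" "awalk_cost w q \<le> dst w h v"
  shows "p = q"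
  using assms
proof (induction p arbitrary: q v rule: rev_induct)
  case Nil
  then have "v = s" by (simp add: awalk_Nil_iff)
  then show ?case
    using optimal_snoc(1,4)[of "butlast q" "last q" v] set_history(2)[OF hist, of "fst (last q)" s] Nil
    by (cases "q = []") auto
next
  case (snoc e p)
  note e = optimal_snoc[OF snoc.prems(1,2)]
  show ?case
  proof (cases q rule: rev_cases)
    case Nil
    then have "v = s" using snoc.prems by (simp add: awalk_Nil_iff)
    then show ?thesis using e(1,4) set_history(2)[OF hist, of "fst e" s] by auto
  next
    case (snoc q' f)
    note f = optimal_snoc[OF snoc.prems(3,4)[unfolded snoc]]
    have "fst e = fst f"
      using history_unique_parent[OF hist] e(1,4) f(1,4) by (metis prod.collapse)
    moreover from this have "e = f" using e(4) f(4) by (simp add: prod_eq_iff)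
    ultimately show ?thesis using snoc.IH[OF e(2,3)] f(2,3) snoc by simp
  qed
qed

text \<open>A nonempty arc list determines the end points that \<open>shortest_path\<close>
  quantifies over, and the tree path is then a competitor.\<close>

lemma shortest_path_optimal:
  assumes "shortest_path w p" "apath s p v" "p \<noteq> []"
  shows "awalk_cost w p \<le> dst w h v"
proof -
  from assms(1) obtain a b where ab: "apath a p b"
    "\<And>q. apath a q b \<Longrightarrow> awalk_cost w p \<le> awalk_cost w q"
    unfolding shortest_path_def by blast
  have "a = s" "b = v"
    using awalk_ends[of s p v a b] assms(2,3) ab(1) by (auto simp: apath_def)
  moreover have "v \<in> reached s h"
    using reached_all[OF hist full] assms(2) awalk_last_in_verts by (auto simp: apath_def)
  ultimately show ?thesis using settled_path[OF hist, of v w] ab(2) by fastforce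
qed

end

end

lemma shortest_path_reverse:
  assumes "wf_digraph.shortest_path (Kn n) w p"
  shows "wf_digraph.shortest_path (Kn n) (flip n w) (rev (map prod.swap p))"
proof -
  interpret graph "Kn n" by (rule graph_Kn)
  have cost: "awalk_cost (flip n w) q = awalk_cost w (rev (map prod.swap q))"
    if "set q \<subseteq> arcs (Kn n)" for q
    using that by (induction q) (auto simp: flip_def)
  have arcs: "set q \<subseteq> arcs (Kn n)" if "apath u q v" for u q v
    using that by (auto simp: apath_def awalk_def)
  from assms obtain u v where p: "apath u p v"
    "\<And>q. apath u q v \<Longrightarrow> awalk_cost w p \<le> awalk_cost w q"
    unfolding shortest_path_def by blast
  have "awalk_cost (flip n w) (rev (map prod.swap p)) = awalk_cost w p"
    using cost[OF arcs[OF apath_Kn_reverse[OF p(1)]]] by (simp add: rev_map o_def)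
  moreover have "awalk_cost w p \<le> awalk_cost (flip n w) q" if "apath v q u" for q
    using p(2)[OF apath_Kn_reverse[OF that]] cost[OF arcs[OF that]] by simp
  ultimately show ?thesis
    using apath_Kn_reverse[OF p(1)] unfolding shortest_path_def by metis
qed

section \<open>Counting locally shortest paths by their first and last arcs\<close>

lemma card_children:
  assumes "distinct h"
  shows "card {v. (u, v) \<in> set h} = children h u"
proof -
  have "card {v. (u, v) \<in> set h} = card (Pair u ` {v. (u, v) \<in> set h})"
    by (rule card_image[symmetric]) (auto intro: inj_onI)
  also have "Pair u ` {v. (u, v) \<in> set h} = set (filter (\<lambda>e. fst e = u) h)" by auto
  also have "card \<dots> = children h u"
    unfolding children_def using assms by (intro distinct_card distinct_filter)
  finally show ?thesis .
qed

lemma card_LSP_le: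
  assumes pos: "\<And>e. e \<in> arcs (Kn n) \<Longrightarrow> 0 < w e"
    and h: "\<And>s. s < n \<Longrightarrow> history n s (h s) \<and> Suc (length (h s)) = n \<and> settled n s w (h s)"
    and g: "\<And>s. s < n \<Longrightarrow> history n s (g s) \<and> Suc (length (g s)) = n \<and> settled n s (flip n w) (g s)"
  shows "real (card (wf_digraph.LSP (Kn n) w))
    \<le> real n ^ 2 + ((\<Sum>a<n. sq_children n (h a)) + (\<Sum>b<n. sq_children n (g b))) / 2"
proof -
  interpret graph "Kn n" by (rule graph_Kn)
  have pos': "0 < flip n w e" if "e \<in> arcs (Kn n)" for e
    using that pos[of "prod.swap e"] by (cases e) (auto simp: flip_def)
  define L where "L = {p \<in> LSP w. 2 \<le> length p}"
  \<comment> \<open>The candidates for first and last arc, grouped by the inner end points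
    \<open>a\<close> and \<open>b\<close>. The tree \<open>g b\<close> lives in the reversed graph,
    so its arc \<open>(a, u)\<close> stands for the arc \<open>(u, a)\<close>.\<close>
  define C where "C = (\<lambda>(a, b). {((u, a), (b, v)) | u v. (a, u) \<in> set (g b) \<and> (b, v) \<in> set (h a)})"
  have L: "\<exists>u a b v m. p = (u, a) # m @ [(b, v)] \<and> a < n \<and> b < n \<and>
      (b, v) \<in> set (h a) \<and> (a, u) \<in> set (g b) \<and> awalk a m b \<and> awalk_cost w m \<le> dst w (h a) b"
    if "p \<in> L" for p
  proof -
    from that obtain e1 m e2 where p: "p = e1 # m @ [e2]"
      unfolding L_def by (cases p; cases "tl p" rule: rev_cases) auto
    obtain u a b v where e: "e1 = (u, a)" "e2 = (b, v)" by force
    from that obtain x y where path: "apath x p y" and sp: "shortest_path w (tl p)"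
      "shortest_path w (butlast p)" by (auto simp: L_def LSP_def)
    have path1: "apath a (m @ [e2]) y" and x: "x = u" using path by (auto simp: p e apath_Cons_iff)
    have path2: "apath u (e1 # m) b"
      using path apath_append_iff[of x "e1 # m" "[e2]" y] x by (auto simp: p e apath_Cons_iff)
    have ab: "a < n" "b < n"
      using path1 path2 awalk_hd_in_verts awalk_last_in_verts by (fastforce simp: apath_def)+
    interpret A: search n a by unfold_locales fact
    interpret B: search n b by unfold_locales fact
    note hA = h[OF ab(1), THEN conjunct1] h[OF ab(1), THEN conjunct2, THEN conjunct1]
      h[OF ab(1), THEN conjunct2, THEN conjunct2] pos
    note gB = g[OF ab(2), THEN conjunct1] g[OF ab(2), THEN conjunct2, THEN conjunct1]
      g[OF ab(2), THEN conjunct2, THEN conjunct2] pos'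
    have walk1: "awalk a (m @ [e2]) y" using path1 by (simp add: apath_def)
    have "awalk_cost w (m @ [e2]) \<le> dst w (h a) y"
      using A.shortest_path_optimal[OF hA _ path1] sp(1) by (simp add: p)
    note opt1 = A.optimal_snoc[OF hA walk1 this]
    \<comment> \<open>Reversing the path without its last arc turns its first arc into a last one,
      to which \<open>optimal_snoc\<close> applies at root \<open>b\<close>.\<close>
    have path3: "apath b (rev (map prod.swap m) @ [(a, u)]) u"
      using apath_Kn_reverse[OF path2] by (simp add: e)
    have "shortest_path (flip n w) (rev (map prod.swap m) @ [(a, u)])"
      using shortest_path_reverse[OF sp(2)] by (simp add: p e)
    from B.shortest_path_optimal[OF gB this path3]
    have "awalk_cost (flip n w) (rev (map prod.swap m) @ [(a, u)]) \<le> dst (flip n w) (g b) u" by simp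
    from B.optimal_snoc(1)[OF gB _ this] path3 have "(a, u) \<in> set (g b)" by (simp add: apath_def)
    with opt1 ab show ?thesis by (auto simp: p e)
  qed
  \<comment> \<open>The middle part is recovered from the two outer arcs as the unique optimal walk
    from \<open>a\<close> to \<open>b\<close>.\<close>
  have inj: "inj_on (\<lambda>p. (hd p, last p)) L"
  proof (rule inj_onI)
    fix p q assume pq: "p \<in> L" "q \<in> L" "(hd p, last p) = (hd q, last q)"
    from L[OF pq(1)] obtain u a b v m where p: "p = (u, a) # m @ [(b, v)]" "a < n"
      "awalk a m b" "awalk_cost w m \<le> dst w (h a) b" by blast
    from L[OF pq(2)] pq(3) obtain m' where q: "q = (u, a) # m' @ [(b, v)]"
      "awalk a m' b" "awalk_cost w m' \<le> dst w (h a) b" using p by auto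
    interpret search n a by unfold_locales fact
    have "m = m'"
      using optimal_unique[of "h a" w m b m'] h[OF p(2)] pos p q by blast
    then show "p = q" using p q by simp
  qed
  have finC: "finite (C ab)" and cardC: "card (C ab) = children (g (snd ab)) (fst ab) * children (h (fst ab)) (snd ab)"
    if mem: "ab \<in> {..<n} \<times> {..<n}" for ab
  proof -
    obtain a b where ab: "ab = (a, b)" "a < n" "b < n" using mem by (cases ab) auto
    interpret A: search n a by unfold_locales fact
    interpret B: search n b by unfold_locales fact
    have eq: "C ab = (\<lambda>(u, v). ((u, a), (b, v))) ` ({u. (a, u) \<in> set (g b)} \<times> {v. (b, v) \<in> set (h a)})"
      by (auto simp: C_def ab image_iff)
    have fin: "finite {v. (c, v) \<in> set l}" for c :: nat and l :: "(nat \<times> nat) list"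
      by (rule finite_subset[of _ "snd ` set l"]) force+
    show "finite (C ab)" unfolding eq using fin by simp
    have "card (C ab) = card {u. (a, u) \<in> set (g b)} * card {v. (b, v) \<in> set (h a)}"
      unfolding eq by (subst card_image) (auto intro!: inj_onI simp: card_cartesian_product)
    then show "card (C ab) = children (g (snd ab)) (fst ab) * children (h (fst ab)) (snd ab)"
      using A.distinct_history B.distinct_history h g ab by (simp add: card_children)
  qed
  have "(\<lambda>p. (hd p, last p)) ` L \<subseteq> (\<Union>ab\<in>{..<n} \<times> {..<n}. C ab)"
  proof
    fix x assume "x \<in> (\<lambda>p. (hd p, last p)) ` L"
    then obtain p where "p \<in> L" "x = (hd p, last p)" by auto
    with L[of p] show "x \<in> (\<Union>ab\<in>{..<n} \<times> {..<n}. C ab)" unfolding C_def by fastforce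
  qed
  then have "card L \<le> card (\<Union>ab\<in>{..<n} \<times> {..<n}. C ab)"
    using finC by (intro card_inj_on_le[OF inj]) auto
  also have "\<dots> \<le> (\<Sum>ab\<in>{..<n} \<times> {..<n}. card (C ab))"
    by (intro card_UN_le) auto
  also have "\<dots> = (\<Sum>ab\<in>{..<n} \<times> {..<n}. children (g (snd ab)) (fst ab) * children (h (fst ab)) (snd ab))"
    using cardC by (intro sum.cong) auto
  also have "\<dots> = (\<Sum>a<n. \<Sum>b<n. children (g b) a * children (h a) b)"
    by (simp add: sum.cartesian_product case_prod_unfold)
  finally have "real (card L) \<le> (\<Sum>a<n. \<Sum>b<n. real (children (g b) a) * real (children (h a) b))"
    by (metis (mono_tags, lifting) of_nat_le_iff of_nat_mult of_nat_sum sum.cong)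
  also have "\<dots> \<le> (\<Sum>a<n. \<Sum>b<n. ((real (children (h a) b))\<^sup>2 + (real (children (g b) a))\<^sup>2) / 2)"
  proof (intro sum_mono)
    fix a b
    show "real (children (g b) a) * real (children (h a) b)
      \<le> ((real (children (h a) b))\<^sup>2 + (real (children (g b) a))\<^sup>2) / 2"
      using sum_squares_bound[of "real (children (g b) a)" "real (children (h a) b)"] by simp
  qed
  also have "\<dots> = ((\<Sum>a<n. sq_children n (h a)) + (\<Sum>a<n. \<Sum>b<n. (real (children (g b) a))\<^sup>2)) / 2"
    by (simp add: sq_children_def sum.distrib sum_divide_distrib[symmetric])
  also have "(\<Sum>a<n. \<Sum>b<n. (real (children (g b) a))\<^sup>2) = (\<Sum>b<n. sq_children n (g b))"
    unfolding sq_children_def by (rule sum.swap)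
  finally have cardL: "real (card L) \<le> ((\<Sum>a<n. sq_children n (h a)) + (\<Sum>b<n. sq_children n (g b))) / 2" .
  have "LSP w \<subseteq> (\<lambda>e. [e]) ` ({..<n} \<times> {..<n}) \<union> L"
  proof
    fix p assume p: "p \<in> LSP w"
    show "p \<in> (\<lambda>e. [e]) ` ({..<n} \<times> {..<n}) \<union> L"
    proof (cases "2 \<le> length p")
      case False
      with p obtain e where e: "p = [e]" by (cases p) (auto simp: LSP_def Suc_le_eq)
      with p have "e \<in> arcs (Kn n)" by (auto simp: LSP_def apath_def awalk_def)
      then show ?thesis using e by (cases e) auto
    qed (use p in \<open>simp add: L_def\<close>)
  qed
  then have "card (LSP w) \<le> card ((\<lambda>e. [e]) ` ({..<n} \<times> {..<n}) \<union> L)"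
    using finite_LSP[of w] by (intro card_mono) (auto simp: L_def)
  also have "\<dots> \<le> card ((\<lambda>e. [e]) ` ({..<n} \<times> {..<n})) + card L"
    by (rule card_Un_le)
  also have "card ((\<lambda>e. [e]) ` ({..<n} \<times> {..<n})) = n * n"
    by (subst card_image) (auto intro: inj_onI simp: card_cartesian_product)
  finally have "real (card (LSP w)) \<le> real (n * n + card L)" by (rule of_nat_mono)
  with cardL show ?thesis by (simp add: power2_eq_square field_simps)
qed

section \<open>The tail bound\<close>

text \<open>Swapping end points permutes the arcs, and the weights are independent and identically
  distributed.\<close>

lemma distr_flip: "distr (weights n) (weights n) (flip n) = weights n"
proof -
  have "prod.swap \<in> arcs (Kn n) \<rightarrow> arcs (Kn n)" by auto
  then show ?thesis
    using distr_PiM_reindex[of "arcs (Kn n)" "\<lambda>_. unif" prod.swap "arcs (Kn n)"] prob_space_unif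
    by (simp add: weights_eq flip_def[abs_def] inj_on_subset[OF inj_swap])
qed

lemma measurable_flip: "flip n \<in> measurable (weights n) (weights n)"
  unfolding weights_eq flip_def[abs_def]
  by (intro measurable_restrict measurable_component_singleton) auto

text \<open>The tangent of the square at \<open>n\<close>, in the role of the Cauchy-Schwarz
  inequality. The point \<open>n\<close> is the average of \<open>2 * n\<close> excesses with sum
  \<open>2 * n ^ 2\<close>.\<close>

lemma sum_squares_ge:
  fixes f :: "nat \<Rightarrow> real"
  shows "(\<Sum>i<n. 2 * real n * f i - (real n)\<^sup>2) \<le> (\<Sum>i<n. (f i)\<^sup>2)"
proof (rule sum_mono)
  fix i show "2 * real n * f i - (real n)\<^sup>2 \<le> (f i)\<^sup>2"
    using zero_le_power2[of "f i - n"] by (simp add: power2_eq_square algebra_simps)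
qed

lemma (in search) sq_excess_ge:
  assumes "history n s h" "Suc (length h) = n" "explores n s w h" "w \<in> space (weights n)"
  shows "(excess n h)\<^sup>2 \<le> sq_excess w"
proof -
  have "h \<in> histories n s (n - 1)" using assms by (auto simp: histories_def)
  moreover have "(excess n h)\<^sup>2 = indicator (explored h) w * (excess n h)\<^sup>2"
    using assms by (simp add: explored_def)
  ultimately show ?thesis
    unfolding sq_excess_def using finite_histories
    by (metis (mono_tags, lifting) member_le_sum mult_nonneg_nonneg indicator_pos_le zero_le_power2)
qed

lemma (in search) exists_exploration:
  assumes "w \<in> space (weights n)" and pos: "\<And>e. e \<in> arcs (Kn n) \<Longrightarrow> 0 < w e" and tf: "tie_free w"
    and hop: "\<And>y. y < n \<Longrightarrow> y \<noteq> s \<Longrightarrow> w \<notin> no_short_two_hop n s y"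
  shows "\<exists>h. history n s h \<and> Suc (length h) = n \<and> settled n s w h \<and> (excess n h)\<^sup>2 \<le> sq_excess w"
proof -
  have "\<exists>z<n. z \<noteq> s \<and> z \<noteq> y \<and> w (s, z) \<le> 1 / 4 \<and> w (z, y) \<le> 1 / 4" if "y < n" "y \<noteq> s" for y
    using hop[OF that] assms(1) by (auto simp: no_short_two_hop_def not_less)
  from explores_complete[OF pos tf this] obtain h
    where "history n s h" "Suc (length h) = n" "explores n s w h" by blast
  then show ?thesis using sq_excess_ge assms(1) by (auto simp: explores_def)
qed

text \<open>\<open>arcs (Kn n)\<close> serves here as the set of ordered pairs of distinct
  vertices.\<close>

definition slow :: "nat \<Rightarrow> (nat \<times> nat \<Rightarrow> real) set" where
  "slow n = (\<Union>(s, y)\<in>arcs (Kn n). no_short_two_hop n s y)"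

lemma not_slow: "w \<notin> slow n \<Longrightarrow> s < n \<Longrightarrow> y < n \<Longrightarrow> y \<noteq> s \<Longrightarrow> w \<notin> no_short_two_hop n s y"
  by (force simp: slow_def)

lemma sets_slow: "slow n \<in> sets (weights n)"
  unfolding slow_def by (intro sets.finite_UN) (auto intro: sets_no_short_two_hop)

lemma emeasure_slow: "emeasure (weights n) (slow n) \<le> ennreal (real n ^ 2 * (15 / 16) ^ (n - 2))"
proof -
  have "emeasure (weights n) (slow n) \<le> (\<Sum>(s, y)\<in>arcs (Kn n). emeasure (weights n) (no_short_two_hop n s y))"
    unfolding slow_def case_prod_unfold
    by (intro emeasure_subadditive_finite) (auto intro: sets_no_short_two_hop)
  also have "\<dots> = (\<Sum>(s, y)\<in>arcs (Kn n). ennreal ((15 / 16) ^ (n - 2)))"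
    by (intro sum.cong) (auto simp: emeasure_no_short_two_hop)
  also have "\<dots> = ennreal (real (card (arcs (Kn n))) * (15 / 16) ^ (n - 2))"
    by (simp add: case_prod_unfold ennreal_mult ennreal_of_nat_eq_real_of_nat)
  also have "\<dots> \<le> ennreal (real n ^ 2 * (15 / 16) ^ (n - 2))"
  proof (intro ennreal_leI mult_right_mono)
    have "card (arcs (Kn n)) \<le> card ({..<n} \<times> {..<n})"
      by (intro card_mono) (auto simp: Kn_def)
    then show "real (card (arcs (Kn n))) \<le> real n ^ 2"
      by (simp add: power2_eq_square card_cartesian_product flip: of_nat_mult)
  qed auto
  finally show ?thesis .
qed

definition total_excess :: "nat \<Rightarrow> (nat \<times> nat \<Rightarrow> real) \<Rightarrow> real" where
  "total_excess n w = (\<Sum>s<n. search.sq_excess n s w)"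

lemma measurable_total_excess: "total_excess n \<in> borel_measurable (weights n)"
  unfolding total_excess_def
  by (intro borel_measurable_sum search.measurable_sq_excess) (simp add: search_def)

lemma total_excess_nonneg: "0 \<le> total_excess n w"
  unfolding total_excess_def
  by (intro sum_nonneg) (simp add: search.sq_excess_def search_def sum_nonneg)

lemma nn_integral_total_excess:
  "(\<integral>\<^sup>+ w. ennreal (total_excess n w) \<partial>weights n) \<le> ennreal (58 * real n ^ 2)"
proof -
  have "(\<integral>\<^sup>+ w. ennreal (total_excess n w) \<partial>weights n)
      = (\<integral>\<^sup>+ w. (\<Sum>s<n. ennreal (search.sq_excess n s w)) \<partial>weights n)"
    unfolding total_excess_def
    by (intro nn_integral_cong sum_ennreal[symmetric]) (simp add: search.sq_excess_def search_def sum_nonneg)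
  also have "\<dots> = (\<Sum>s<n. (\<integral>\<^sup>+ w. ennreal (search.sq_excess n s w) \<partial>weights n))"
    by (intro nn_integral_sum measurable_compose[OF search.measurable_sq_excess measurable_ennreal])
      (simp add: search_def)
  also have "\<dots> \<le> (\<Sum>s<n. ennreal (58 * real n))"
    by (intro sum_mono search.nn_integral_sq_excess) (simp add: search_def)
  also have "\<dots> = ennreal (58 * real n ^ 2)"
    by (simp add: power2_eq_square ennreal_of_nat_eq_real_of_nat ennreal_mult[symmetric] mult_ac)
  finally show ?thesis .
qed

lemma AE_flip:
  assumes "AE w in weights n. P w"
  shows "AE w in weights n. P (flip n w)"
  using AE_distrD[OF measurable_flip] assms distr_flip by metis

lemma many_LSP_imp_excess:
  "AE w in weights n. 8 * real n ^ 2 \<le> real (card (wf_digraph.LSP (Kn n) w)) \<longrightarrow>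
     w \<notin> slow n \<longrightarrow> flip n w \<notin> slow n \<longrightarrow>
     2 * real n ^ 3 \<le> total_excess n w + total_excess n (flip n w)"
proof -
  have tf: "AE w in weights n. \<forall>s\<in>{..<n}. search.tie_free n s w"
    by (intro AE_finite_allI search.AE_tie_free) (auto simp: search_def)
  have "AE w in weights n. w \<in> space (weights n)" by (rule AE_space)
  with tf AE_flip[OF tf] AE_weights_pos[of n] show ?thesis
  proof eventually_elim
    case (elim w)
    show ?case
    proof (intro impI)
      assume many: "8 * real n ^ 2 \<le> real (card (wf_digraph.LSP (Kn n) w))"
        and fast: "w \<notin> slow n" "flip n w \<notin> slow n"
      have space: "flip n w \<in> space (weights n)"
        using measurable_space[OF measurable_flip elim(4)] .
      have pos: "0 < w e" "0 < flip n w e" if "e \<in> arcs (Kn n)" for e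
        using elim(3) that by (cases e; auto simp: flip_def)+
      have "\<forall>s\<in>{..<n}. \<exists>h. history n s h \<and> Suc (length h) = n \<and> settled n s w h \<and>
          (excess n h)\<^sup>2 \<le> search.sq_excess n s w"
        using elim fast pos by (intro ballI search.exists_exploration) (auto simp: search_def not_slow)
      then obtain h where h: "\<And>s. s < n \<Longrightarrow> history n s (h s) \<and> Suc (length (h s)) = n \<and>
          settled n s w (h s) \<and> (excess n (h s))\<^sup>2 \<le> search.sq_excess n s w" by (auto simp: bchoice_iff)
      have "\<forall>s\<in>{..<n}. \<exists>h. history n s h \<and> Suc (length h) = n \<and> settled n s (flip n w) h \<and>
          (excess n h)\<^sup>2 \<le> search.sq_excess n s (flip n w)"
        using elim fast pos space by (intro ballI search.exists_exploration) (auto simp: search_def not_slow)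
      then obtain g where g: "\<And>s. s < n \<Longrightarrow> history n s (g s) \<and> Suc (length (g s)) = n \<and>
          settled n s (flip n w) (g s) \<and> (excess n (g s))\<^sup>2 \<le> search.sq_excess n s (flip n w)"
        by (auto simp: bchoice_iff)
      have bound: "sq_children n l \<le> 6 * n + excess n l" if "Suc (length l) = n" for l
        using that by (auto simp: excess_def)
      have "real (card (wf_digraph.LSP (Kn n) w))
          \<le> real n ^ 2 + ((\<Sum>a<n. sq_children n (h a)) + (\<Sum>b<n. sq_children n (g b))) / 2"
        by (rule card_LSP_le) (use pos h g in auto)
      also have "(\<Sum>a<n. sq_children n (h a)) \<le> (\<Sum>a<n. 6 * n + excess n (h a))"
        using h by (intro sum_mono bound) auto
      also have "(\<Sum>b<n. sq_children n (g b)) \<le> (\<Sum>b<n. 6 * n + excess n (g b))"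
        using g by (intro sum_mono bound) auto
      \<comment> \<open>Of \<open>8 * n ^ 2\<close> paths at most \<open>n ^ 2\<close> are single
        arcs, so the sums over the trees reach \<open>14 * n ^ 2\<close>. The allowance of
        \<open>6 * n\<close> for each of the \<open>2 * n\<close> trees takes
        \<open>12 * n ^ 2\<close> of this.\<close>
      finally have "2 * real n ^ 2 \<le> (\<Sum>a<n. excess n (h a)) + (\<Sum>b<n. excess n (g b))"
        using many by (simp add: sum.distrib power2_eq_square field_simps)
      then have "2 * real n * (2 * real n ^ 2)
          \<le> 2 * real n * ((\<Sum>a<n. excess n (h a)) + (\<Sum>b<n. excess n (g b)))"
        by (intro mult_left_mono) auto
      then have "2 * real n ^ 3 \<le> (\<Sum>a<n. 2 * real n * excess n (h a) - (real n)\<^sup>2)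
          + (\<Sum>b<n. 2 * real n * excess n (g b) - (real n)\<^sup>2)"
        by (simp add: sum_subtractf sum_distrib_left[symmetric] power2_eq_square power3_eq_cube algebra_simps)
      also have "\<dots> \<le> (\<Sum>a<n. (excess n (h a))\<^sup>2) + (\<Sum>b<n. (excess n (g b))\<^sup>2)"
        by (intro add_mono sum_squares_ge)
      also have "\<dots> \<le> total_excess n w + total_excess n (flip n w)"
        unfolding total_excess_def using h g by (intro add_mono sum_mono) auto
      finally show "2 * real n ^ 3 \<le> total_excess n w + total_excess n (flip n w)" .
    qed
  qed
qed

lemma prob_many_LSP:
  assumes n: "0 < n"
  shows "measure (weights n) {w \<in> space (weights n). 8 * real n ^ 2 \<le> real (card (wf_digraph.LSP (Kn n) w))}
    \<le> 58 / n + 2 * (real n ^ 2 * (15 / 16) ^ (n - 2))"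
proof -
  interpret prob_space "weights n" by (rule prob_space_weights)
  note [measurable] = measurable_total_excess measurable_flip sets_slow measurable_card_LSP
  define A where "A = {w \<in> space (weights n). 8 * real n ^ 2 \<le> real (card (wf_digraph.LSP (Kn n) w))}"
  define T where "T w = total_excess n w + total_excess n (flip n w)" for w
  define X where "X = {w \<in> space (weights n). 2 * real n ^ 3 \<le> T w}"
  define S where "S = flip n -` slow n \<inter> space (weights n)"
  have [measurable]: "T \<in> borel_measurable (weights n)" unfolding T_def by measurable
  have sets: "A \<in> events" "X \<in> events" "S \<in> events"
    unfolding A_def X_def S_def by measurable
  have slow: "prob (slow n) \<le> real n ^ 2 * (15 / 16) ^ (n - 2)"
    using emeasure_slow[of n] by (simp add: emeasure_eq_measure)
  have "prob S = measure (distr (weights n) (weights n) (flip n)) (slow n)"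
    unfolding S_def by (simp add: measure_distr)
  then have S: "prob S = prob (slow n)" by (simp add: distr_flip)
  have X: "prob X \<le> 58 / n"
  proof -
    have "(\<integral>\<^sup>+ w. ennreal (total_excess n (flip n w)) \<partial>weights n)
        = (\<integral>\<^sup>+ w. ennreal (total_excess n w) \<partial>distr (weights n) (weights n) (flip n))"
      by (rule nn_integral_distr[symmetric]) measurable
    then have "(\<integral>\<^sup>+ w. ennreal (total_excess n (flip n w)) \<partial>weights n) \<le> ennreal (58 * real n ^ 2)"
      using nn_integral_total_excess[of n] by (simp add: distr_flip)
    moreover have "(\<integral>\<^sup>+ w. ennreal (T w) \<partial>weights n) = (\<integral>\<^sup>+ w. ennreal (total_excess n w) \<partial>weights n)
        + (\<integral>\<^sup>+ w. ennreal (total_excess n (flip n w)) \<partial>weights n)"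
      unfolding T_def by (simp add: ennreal_plus total_excess_nonneg nn_integral_add)
    ultimately have int: "(\<integral>\<^sup>+ w. ennreal (T w) \<partial>weights n) \<le> ennreal (58 * real n ^ 2) + ennreal (58 * real n ^ 2)"
      using nn_integral_total_excess[of n] by (simp add: add_mono)
    \<comment> \<open>Markov's inequality: the mean of \<open>T\<close> is at most
      \<open>116 * n ^ 2\<close>, the threshold is \<open>2 * n ^ 3\<close>, and the quotient is
      \<open>58 / n\<close>.\<close>
    have "ennreal (2 * real n ^ 3) * emeasure (weights n) X
        = (\<integral>\<^sup>+ w. ennreal (2 * real n ^ 3) * indicator X w \<partial>weights n)"
      using sets by (simp add: nn_integral_cmult)
    also have "\<dots> \<le> (\<integral>\<^sup>+ w. ennreal (T w) \<partial>weights n)"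
      by (intro nn_integral_mono) (auto simp: X_def indicator_def ennreal_leI)
    also note int
    finally have "ennreal (2 * real n ^ 3 * prob X) \<le> ennreal (116 * real n ^ 2)"
      by (simp add: emeasure_eq_measure ennreal_mult[symmetric] ennreal_plus[symmetric] del: ennreal_plus)
    then have "2 * real n ^ 3 * prob X \<le> 116 * real n ^ 2"
      by (simp add: ennreal_le_iff)
    then have "(2 * real n ^ 2) * (n * prob X) \<le> (2 * real n ^ 2) * 58"
      by (simp add: power2_eq_square power3_eq_cube)
    then have "n * prob X \<le> 58" using n by (simp add: mult_le_cancel_left)
    then show ?thesis using n by (simp add: field_simps)
  qed
  have "prob A \<le> prob (X \<union> (slow n \<union> S))"
  proof (rule finite_measure_mono_AE)
    show "AE w in weights n. w \<in> A \<longrightarrow> w \<in> X \<union> (slow n \<union> S)"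
      using many_LSP_imp_excess[of n] by eventually_elim (auto simp: A_def X_def S_def T_def)
  qed (use sets sets_slow in auto)
  also have "\<dots> \<le> prob X + (prob (slow n) + prob S)"
    using sets sets_slow
    by (intro order_trans[OF measure_Un_le] add_left_mono) auto
  also have "\<dots> \<le> 58 / n + 2 * (real n ^ 2 * (15 / 16) ^ (n - 2))"
    using X S slow by simp
  finally show ?thesis by (simp add: A_def)
qed

theorem theorem30:
  shows "\<exists>c :: real.
    (\<lambda>n. \<P>(w in weights n. real (card (wf_digraph.LSP (Kn n) w)) \<ge> c * real n ^ 2))
      \<in> O(\<lambda>n. real n powr (- 1 / 26))"
proof
  \<comment> \<open>The witness is \<open>c = 8\<close>; the decay of order 1/n is faster than the
    required one.\<close>
  have "(\<lambda>n. \<P>(w in weights n. real (card (wf_digraph.LSP (Kn n) w)) \<ge> 8 * real n ^ 2))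
    \<in> O(\<lambda>n. 58 / n + 2 * (real n ^ 2 * (15 / 16) ^ (n - 2)))"
    using prob_many_LSP by (intro landau_o.bigI[of 1] eventually_sequentiallyI[of 1]) auto
  also have "(\<lambda>n. 58 / n + 2 * (real n ^ 2 * (15 / 16) ^ (n - 2))) \<in> O(\<lambda>n. real n powr (- 1 / 26))"
    by real_asymp
  finally show "(\<lambda>n. \<P>(w in weights n. real (card (wf_digraph.LSP (Kn n) w)) \<ge> 8 * real n ^ 2))
      \<in> O(\<lambda>n. real n powr (- 1 / 26))" .
qed

end
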